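(* Let $M$ be a connected, simply connected, oriented smooth surface, let $f:M\to\mathbb{R}^4$ be an elliptic Lagrangian immersion, equip $M$ with the complex structure induced by $f$, and let $(U,z)$ be a complex parameter on $M$. Then there exist third order frame fields $\mathbf{S}:U\to\mathcal{S}(4,\mathbb{R})$ along $f$ adapted to $(U,z)$. If $\mathbf{S}=\mathbf{S}(f,\mathbf{X})$ and $\mathbf{S}'=\mathbf{S}(f,\mathbf{X}')$ are two such frame fields, then $\mathbf{S}'=\pm\mathbf{S}$, in the sense that $\mathbf{X}'=\mathbf{X}$ on $U$ or $\mathbf{X}'=-\mathbf{X}$ on $U$.
   Context: Symplectic group. $\mathbb{R}^4$ carries the symplectic form $\Omega(X,Y)={}^tXJY$, $J=\begin{pmatrix}0&I_2\\-I_2&0\end{pmatrix}$. $\mathrm{Sp}(4,\mathbb{R})=\{\mathbf{X}\in\mathrm{GL}(4,\mathbb{R}):{}^t\mathbf{X}J\mathbf{X}=J\}$. The affine symplectic group $\mathcal{S}(4,\mathbb{R})=\mathbb{R}^4\rtimes\mathrm{Sp}(4,\mathbb{R})$ consists of the matrices $\mathbf{S}(P,\mathbf{X})=\begin{pmatrix}1&0\\P&\mathbf{X}\end{pmatrix}$, $P\in\mathbb{R}^4$, $\mathbf{X}\in\mathrm{Sp}(4,\mathbb{R})$. Lagrangian immersions. A smooth immersion $f:M\to\mathbb{R}^4$ is Lagrangian if $f^*\Omega=0$. Its Gauss map $\mathcal{T}_f$ sends $q$ to the plane $df(T_qM)$, translated to the origin, with the orientation OPPOSITE to the one induced by $df$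 from $M$; it takes values in the manifold $\Lambda_2^+$ of oriented Lagrangian 2-planes. A symplectic frame field along $f$ on an open connected set $U\subset M$ is a smooth map $\mathbf{S}=\mathbf{S}(f,\mathbf{X}):U\to\mathcal{S}(4,\mathbb{R})$; write $X_1,\dots,X_4$ for the columns of $\mathbf{X}$. Define real 1-forms on $U$ by $df=\sum_j\tau^jX_j$, $dX_j=\sum_i\theta^i_jX_i$, with $\theta=\begin{pmatrix}\alpha&\beta\\\gamma&-{}^t\alpha\end{pmatrix}$, where $\alpha=(\alpha^i_j)$ is $2\times2$ ($i$ row, $j$ column) and $\beta=(\beta^i_j)$, $\gamma=(\gamma^i_j)$ are symmetric $2\times2$. The frame is of first order if $\mathcal{T}_f=[X_1\wedge X_2]$ as oriented planes (equivalently $\tau^3=\tau^4=0$ and $\tau^1\wedge\tau^2<0$). $f$ is elliptic if its Gauss map is a spacelike immersion for the natural signature $(2,1)$ conformal structure of $\Lambda_2^+$, i.e. if for first order frames the quadratic form $g=-\gamma^1_1\gamma^2_2+(\gamma^2_1)^2$ is positive definite. The conformal class of $g$ does not depend on the first order frame; with the orientation of $M$ it defines the complex structure on $M$ induced by $f$. Higher order frames. A first order frame is of second order if $\gamma^1_1+\gamma^2_2=0$. For such a frame put $\omega=\tfrac12(\gamma^1_1-\gamma^2_2)+i\gamma^2_1$ and $\eta=\tfrac12(\alpha^1_1-\alpha^2_2)-\tfrac i2(\alpha^2_1+\alpha^1_2)$. Then $\omega$ is a nowhere zero $(1,0)$-form and $\eta=h\omega+\ell\bar\omega$ with $h$ complex-valued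 and $\ell$ real-valued. The frame is of third order if $\ell=0$. Adapted frames. A complex parameter $(U,z)$ on $M$ is a holomorphic chart $z:U\to\mathbb{C}$ on a maximal contractible open set $U$ ($U=M$ if $M$ is biholomorphic to $\mathbb{C}$ or the unit disk; $U=M$ minus a point if $M$ is the Riemann sphere). A third order frame $\mathbf{S}:U\to\mathcal{S}(4,\mathbb{R})$ along $f$ is adapted to $(U,z)$ if $\omega=dz$ and $\alpha^1_1+\alpha^2_2=\alpha^2_1-\alpha^1_2=0$. *)

theory Defs
  imports "HOL-Analysis.Analysis"
begin

section \<open>Smooth maps between open subsets of normed spaces\<close>

(* Meant for open S in a finite-dimensional space: all iterated directional derivatives of
   order at most k exist (as Frechet derivatives) and are continuous. *)
primrec ck_on :: "nat \<Rightarrow> 'a::real_normed_vector set \<Rightarrow> ('a \<Rightarrow> 'b::real_normed_vector) \<Rightarrow> bool" where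
  "ck_on 0 S F \<longleftrightarrow> continuous_on S F"
| "ck_on (Suc k) S F \<longleftrightarrow>
     (\<forall>x\<in>S. F differentiable (at x)) \<and> (\<forall>v. ck_on k S (\<lambda>x. frechet_derivative F (at x) v))"

definition smooth_on :: "'a::real_normed_vector set \<Rightarrow> ('a \<Rightarrow> 'b::real_normed_vector) \<Rightarrow> bool" where
  "smooth_on S F \<longleftrightarrow> (\<forall>k. ck_on k S F)"


section \<open>Oriented smooth surfaces\<close>

(* The surface is the whole type 'm; its smooth structure and orientation are given by an
   oriented atlas, which need not be maximal. *)

type_synonym 'm chart = "'m set \<times> ('m \<Rightarrow> real^2)"

definition coord_rep :: "'m chart \<Rightarrow> ('m \<Rightarrow> 'b) \<Rightarrow> real^2 \<Rightarrow> 'b" where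
  "coord_rep c F = F \<circ> inv_into (fst c) (snd c)"

definition oriented_surface :: "'m::{t2_space,second_countable_topology} chart set \<Rightarrow> bool" where
  "oriented_surface A \<longleftrightarrow>
     (\<forall>c\<in>A. open (fst c) \<and> open (snd c ` fst c) \<and>
        homeomorphism (fst c) (snd c ` fst c) (snd c) (inv_into (fst c) (snd c))) \<and>
     (\<Union>c\<in>A. fst c) = UNIV \<and>
     (\<forall>c\<in>A. \<forall>c'\<in>A. smooth_on (snd c ` (fst c \<inter> fst c')) (coord_rep c (snd c'))) \<and>
     (\<forall>c\<in>A. \<forall>c'\<in>A. \<forall>x\<in>snd c ` (fst c \<inter> fst c').
        det (matrix (frechet_derivative (coord_rep c (snd c')) (at x))) > 0)"

definition charts_at :: "'m chart set \<Rightarrow> 'm \<Rightarrow> 'm chart set" where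
  "charts_at A q = {c \<in> A. q \<in> fst c}"

definition smooth_map ::
    "'m::topological_space chart set \<Rightarrow> 'm set \<Rightarrow> ('m \<Rightarrow> 'b::real_normed_vector) \<Rightarrow> bool" where
  "smooth_map A U F \<longleftrightarrow> (\<forall>c\<in>A. smooth_on (snd c ` (fst c \<inter> U)) (coord_rep c F))"

(* A tangent vector at q is the family of its coordinate vectors in all charts around q,
   transforming by the Jacobians of the chart changes; it is 0 on the irrelevant charts. *)
type_synonym 'm tvec = "'m chart \<Rightarrow> real^2"

definition tangent_space :: "'m chart set \<Rightarrow> 'm \<Rightarrow> 'm tvec set" where
  "tangent_space A q = {v.
     (\<forall>c\<in>charts_at A q. \<forall>c'\<in>charts_at A q.
        v c' = frechet_derivative (coord_rep c (snd c')) (at (snd c q)) (v c)) \<and>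
     (\<forall>c. c \<notin> charts_at A q \<longrightarrow> v c = 0)}"

(* (v, w) is a positively oriented basis of the tangent space at q. *)
definition pos_basis :: "'m chart set \<Rightarrow> 'm \<Rightarrow> 'm tvec \<Rightarrow> 'm tvec \<Rightarrow> bool" where
  "pos_basis A q v w \<longleftrightarrow> v \<in> tangent_space A q \<and> w \<in> tangent_space A q \<and>
     (\<forall>c\<in>charts_at A q. det (vector [v c, w c] :: real^2^2) > 0)"

(* dF at q applied to a tangent vector; by the chain rule the chosen chart is irrelevant. *)
definition tdiff ::
    "'m chart set \<Rightarrow> ('m \<Rightarrow> 'b::real_normed_vector) \<Rightarrow> 'm \<Rightarrow> 'm tvec \<Rightarrow> 'b" where
  "tdiff A F q v =
     (let c = (SOME c. c \<in> charts_at A q)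
      in frechet_derivative (coord_rep c F) (at (snd c q)) (v c))"


section \<open>The affine symplectic group\<close>

definition J4 :: "real^4^4" where
  "J4 = (\<chi> i j. if (i, j) = (1, 3) \<or> (i, j) = (2, 4) then 1
                else if (i, j) = (3, 1) \<or> (i, j) = (4, 2) then -1 else 0)"

definition symp_form :: "real^4 \<Rightarrow> real^4 \<Rightarrow> real" where
  "symp_form x y = x \<bullet> (J4 *v y)"

definition Sp4 :: "(real^4^4) set" where
  "Sp4 = {X. invertible X \<and> transpose X ** J4 ** X = J4}"

(* 5 x 5 matrices, with index set written as 1 + 4 to display the block structure. *)
type_synonym mat5 = "real^(1 + 4)^(1 + 4)"

definition aff :: "real^4 \<Rightarrow> real^4^4 \<Rightarrow> mat5" where
  "aff P X = (\<chi> i j. case (i, j) of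
      (Inl _, Inl _) \<Rightarrow> 1
    | (Inl _, Inr _) \<Rightarrow> 0
    | (Inr a, Inl _) \<Rightarrow> P $ a
    | (Inr a, Inr b) \<Rightarrow> X $ a $ b)"

definition affine_symplectic :: "mat5 set" where
  "affine_symplectic = {aff P X | P X. X \<in> Sp4}"

definition point_part :: "mat5 \<Rightarrow> real^4" where
  "point_part S = (\<chi> a. S $ Inr a $ Inl 1)"

definition lin_part :: "mat5 \<Rightarrow> real^4^4" where
  "lin_part S = (\<chi> a b. S $ Inr a $ Inr b)"

lemma point_part_aff: "point_part (aff P X) = P"
  by (simp add: point_part_def aff_def)

lemma lin_part_aff: "lin_part (aff P X) = X"
  by (simp add: lin_part_def aff_def)


section \<open>Lagrangian immersions and their Gauss maps\<close>

definition lagrangian_immersion ::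
    "'m::topological_space chart set \<Rightarrow> ('m \<Rightarrow> real^4) \<Rightarrow> bool" where
  "lagrangian_immersion A f \<longleftrightarrow> smooth_map A UNIV f \<and>
     (\<forall>q. inj_on (tdiff A f q) (tangent_space A q)) \<and>
     (\<forall>q. \<forall>v\<in>tangent_space A q. \<forall>w\<in>tangent_space A q.
        symp_form (tdiff A f q v) (tdiff A f q w) = 0)"

(* An oriented plane is represented by the set of its positively oriented bases. *)
definition oriented_plane :: "real^4 \<Rightarrow> real^4 \<Rightarrow> ((real^4) \<times> (real^4)) set" where
  "oriented_plane x y =
     {(a *\<^sub>R x + b *\<^sub>R y, c *\<^sub>R x + d *\<^sub>R y) | a b c d. a * d - b * c > 0}"

(* The swap of v and w reverses the orientation induced by df. *)
definition gauss_map :: "'m chart set \<Rightarrow> ('m \<Rightarrow> real^4) \<Rightarrow> 'm \<Rightarrow> ((real^4) \<times> (real^4)) set" where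
  "gauss_map A f q = {(tdiff A f q w, tdiff A f q v) | v w. pos_basis A q v w}"


section \<open>Symplectic frame fields\<close>

definition symplectic_frame ::
    "'m::topological_space chart set \<Rightarrow> ('m \<Rightarrow> real^4) \<Rightarrow> 'm set \<Rightarrow> ('m \<Rightarrow> mat5) \<Rightarrow> bool" where
  "symplectic_frame A f U S \<longleftrightarrow> open U \<and> connected U \<and> smooth_map A U S \<and>
     (\<forall>q\<in>U. S q \<in> affine_symplectic \<and> point_part (S q) = f q)"

(* d X_j = sum_i theta^i_j X_i for the columns X_j says d X = X theta. *)
definition theta :: "'m chart set \<Rightarrow> ('m \<Rightarrow> mat5) \<Rightarrow> 'm \<Rightarrow> 'm tvec \<Rightarrow> real^4^4" where
  "theta A S q v = matrix_inv (lin_part (S q)) ** tdiff A (\<lambda>p. lin_part (S p)) q v"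

lemma theta_structure_equation:
  assumes "S q \<in> affine_symplectic"
  shows "column j (tdiff A (\<lambda>p. lin_part (S p)) q v) =
           (\<Sum>i\<in>UNIV. theta A S q v $ i $ j *\<^sub>R column i (lin_part (S q)))"
proof -
  have "invertible (lin_part (S q))"
    using assms by (auto simp: affine_symplectic_def Sp4_def lin_part_aff)
  then have "lin_part (S q) ** matrix_inv (lin_part (S q)) = mat 1"
    unfolding invertible_def matrix_inv_def by (rule someI2_ex) simp
  then have "lin_part (S q) ** theta A S q v = tdiff A (\<lambda>p. lin_part (S p)) q v"
    by (simp add: theta_def matrix_mul_assoc)
  then have "tdiff A (\<lambda>p. lin_part (S p)) q v $ a $ j =
      (\<Sum>i\<in>UNIV. lin_part (S q) $ a $ i * theta A S q v $ i $ j)" for a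
    by (metis (no_types, lifting) matrix_matrix_mult_def sum.cong vec_lambda_beta)
  then show ?thesis
    by (simp add: vec_eq_iff column_def mult.commute)
qed

(* The blocks of theta: row index i, column index j, where i and j range over 1, 2 only. *)
definition alpha :: "'m chart set \<Rightarrow> ('m \<Rightarrow> mat5) \<Rightarrow> 4 \<Rightarrow> 4 \<Rightarrow> 'm \<Rightarrow> 'm tvec \<Rightarrow> real" where
  "alpha A S i j q v = theta A S q v $ i $ j"

definition gamma :: "'m chart set \<Rightarrow> ('m \<Rightarrow> mat5) \<Rightarrow> 4 \<Rightarrow> 4 \<Rightarrow> 'm \<Rightarrow> 'm tvec \<Rightarrow> real" where
  "gamma A S i j q v = theta A S q v $ (i + 2) $ j"

definition first_order ::
    "'m::topological_space chart set \<Rightarrow> ('m \<Rightarrow> real^4) \<Rightarrow> 'm set \<Rightarrow> ('m \<Rightarrow> mat5) \<Rightarrow> bool" where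
  "first_order A f U S \<longleftrightarrow> symplectic_frame A f U S \<and>
     (\<forall>q\<in>U. gauss_map A f q =
        oriented_plane (column 1 (lin_part (S q))) (column 2 (lin_part (S q))))"

definition gform :: "'m chart set \<Rightarrow> ('m \<Rightarrow> mat5) \<Rightarrow> 'm \<Rightarrow> 'm tvec \<Rightarrow> real" where
  "gform A S q v = - gamma A S 1 1 q v * gamma A S 2 2 q v + (gamma A S 2 1 q v)\<^sup>2"

(* Every point has first order frames nearby, so quantifying over them is not vacuous. *)
definition elliptic_lagrangian_immersion ::
    "'m::topological_space chart set \<Rightarrow> ('m \<Rightarrow> real^4) \<Rightarrow> bool" where
  "elliptic_lagrangian_immersion A f \<longleftrightarrow> lagrangian_immersion A f \<and>
     (\<forall>V S. first_order A f V S \<longrightarrow>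
        (\<forall>q\<in>V. \<forall>v\<in>tangent_space A q. v \<noteq> (\<lambda>_. 0) \<longrightarrow> gform A S q v > 0))"


section \<open>The induced complex structure\<close>

definition complex_chart ::
    "'m::topological_space chart set \<Rightarrow> 'm set \<Rightarrow> ('m \<Rightarrow> complex) \<Rightarrow> bool" where
  "complex_chart A U z \<longleftrightarrow> open U \<and> inj_on z U \<and> open (z ` U) \<and> smooth_map A U z \<and>
     (\<forall>c\<in>A. smooth_on (z ` (U \<inter> fst c)) (snd c \<circ> inv_into U z))"

(* The complex structure given by the conformal class of g and the orientation: its
   holomorphic charts are the positively oriented charts z with g conformal to |dz|^2. *)
definition holomorphic_chart ::
    "'m::topological_space chart set \<Rightarrow> ('m \<Rightarrow> real^4) \<Rightarrow> 'm set \<Rightarrow> ('m \<Rightarrow> complex) \<Rightarrow> bool" where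
  "holomorphic_chart A f U z \<longleftrightarrow> complex_chart A U z \<and>
     (\<forall>q\<in>U. \<forall>v w. pos_basis A q v w \<longrightarrow> Im (cnj (tdiff A z q v) * tdiff A z q w) > 0) \<and>
     (\<forall>V S. first_order A f V S \<longrightarrow>
        (\<forall>q\<in>U \<inter> V. \<exists>r>0. \<forall>v\<in>tangent_space A q. gform A S q v = r * (cmod (tdiff A z q v))\<^sup>2))"

definition complex_parameter ::
    "'m::topological_space chart set \<Rightarrow> ('m \<Rightarrow> real^4) \<Rightarrow> 'm set \<Rightarrow> ('m \<Rightarrow> complex) \<Rightarrow> bool" where
  "complex_parameter A f U z \<longleftrightarrow> holomorphic_chart A f U z \<and>
     open U \<and> contractible U \<and> (\<forall>V. open V \<and> contractible V \<and> U \<subseteq> V \<longrightarrow> V = U)"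


section \<open>Higher order and adapted frames\<close>

definition second_order ::
    "'m::topological_space chart set \<Rightarrow> ('m \<Rightarrow> real^4) \<Rightarrow> 'm set \<Rightarrow> ('m \<Rightarrow> mat5) \<Rightarrow> bool" where
  "second_order A f U S \<longleftrightarrow> first_order A f U S \<and>
     (\<forall>q\<in>U. \<forall>v\<in>tangent_space A q. gamma A S 1 1 q v + gamma A S 2 2 q v = 0)"

definition omega :: "'m chart set \<Rightarrow> ('m \<Rightarrow> mat5) \<Rightarrow> 'm \<Rightarrow> 'm tvec \<Rightarrow> complex" where
  "omega A S q v = Complex ((gamma A S 1 1 q v - gamma A S 2 2 q v) / 2) (gamma A S 2 1 q v)"

definition eta :: "'m chart set \<Rightarrow> ('m \<Rightarrow> mat5) \<Rightarrow> 'm \<Rightarrow> 'm tvec \<Rightarrow> complex" where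
  "eta A S q v = Complex ((alpha A S 1 1 q v - alpha A S 2 2 q v) / 2)
                         (- (alpha A S 2 1 q v + alpha A S 1 2 q v) / 2)"

definition third_order ::
    "'m::topological_space chart set \<Rightarrow> ('m \<Rightarrow> real^4) \<Rightarrow> 'm set \<Rightarrow> ('m \<Rightarrow> mat5) \<Rightarrow> bool" where
  "third_order A f U S \<longleftrightarrow> second_order A f U S \<and>
     (\<exists>(h :: 'm \<Rightarrow> complex) (l :: 'm \<Rightarrow> real).
        (\<forall>q\<in>U. \<forall>v\<in>tangent_space A q.
           eta A S q v = h q * omega A S q v + complex_of_real (l q) * cnj (omega A S q v)) \<and>
        (\<forall>q\<in>U. l q = 0))"

definition adapted_frame ::
    "'m::topological_space chart set \<Rightarrow> ('m \<Rightarrow> real^4) \<Rightarrow> 'm set \<Rightarrow> ('m \<Rightarrow> complex) \<Rightarrow>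
     ('m \<Rightarrow> mat5) \<Rightarrow> bool" where
  "adapted_frame A f U z S \<longleftrightarrow> third_order A f U S \<and>
     (\<forall>q\<in>U. \<forall>v\<in>tangent_space A q.
        omega A S q v = tdiff A z q v \<and>
        alpha A S 1 1 q v + alpha A S 2 2 q v = 0 \<and>
        alpha A S 2 1 q v - alpha A S 1 2 q v = 0)"

end

theory Submission
  imports Defs
begin

text \<open>Push \<open>f\<close> forward along \<open>z\<close> to \<open>F\<close> on the contractible plane domain \<open>D = z ` U\<close>. Write \<open>\<Omega>\<close>
  for the symplectic form; the cubic form \<open>\<Omega>(F_i, F_jk)\<close> is totally symmetric because \<open>f\<close> is
  Lagrangian, and conformality of \<open>g\<close> makes it the real part of \<open>\<kappa> dz\<^sup>3\<close> with \<open>\<kappa>\<close> nowhere zero. The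
  condition \<open>\<omega> = dz\<close> then determines the first two columns up to sign: they arise from \<open>(F_y, F_x)\<close> by
  a rotation and scaling by a square root of the inverse of the conjugate of \<open>\<kappa>\<close>, which exists because
  \<open>D\<close> is contractible. The last two columns may still be changed by a symmetric \<open>2 \<times> 2\<close> matrix \<open>s\<close>,
  which changes \<open>\<alpha>\<close> into \<open>\<alpha> - s\<gamma>\<close>. The equation \<open>d\<theta> + \<theta> \<and> \<theta> = 0\<close>, that is the symmetry of second
  derivatives, implies that exactly one \<open>s\<close> meets the remaining conditions on \<open>\<alpha>\<close>.\<close>

section \<open>Calculus of smooth maps\<close>

text \<open>The count behind the uniqueness of \<open>s\<close>: \<alpha> has eight real
  coefficients, and adaptedness imposes six real equations on them, two each for the trace, the skew
  part and the type of \<eta>, while \<open>s\<close> offers only three parameters. Since \<omega> =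
  dz makes all entries of \<gamma> closed, the \<gamma> block of the structure equation degenerates
  to three linear relations between the coefficients of \<alpha>. They leave three conditions: two
  parameters of \<open>s\<close> remove the trace and with it the skew part, the trace of
  \<open>s\<close> removes the coefficient \<open>l\<close> of \<eta>, and the two remaining
  coefficients are the real and imaginary parts of \<open>h\<close>. All these conditions involve
  only pairings \<Omega>(column, differential of one of the first two columns). The last two columns
  are never differentiated, and no inverse matrix has to be computed. The square root is found by
  topology and is a priori only continuous; its smoothness needs a separate argument. The order
  (F_y, F_x) reflects the reversed orientation in the Gauss map.\<close>

lemma ck_on_Suc_imp_ck_on: "ck_on (Suc k) S F \<Longrightarrow> ck_on k S F"
proof (induction k arbitrary: F)
  case 0
  then show ?case
    by (auto intro!: continuous_at_imp_continuous_on differentiable_imp_continuous_within)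
next
  case (Suc k)
  then have "\<forall>x\<in>S. F differentiable (at x)" "\<forall>v. ck_on (Suc k) S (\<lambda>x. frechet_derivative F (at x) v)"
    unfolding ck_on.simps(2)[of "Suc k"] by blast+
  with Suc.IH show ?case
    unfolding ck_on.simps(2)[of k] by blast
qed

text \<open>\<open>frechet_derivative\<close> at a point depends only on the germ there, so on an
  open set equality passes to all derivatives. This allows a map to be replaced by a formula that is
  valid only on its domain.\<close>

lemma ck_on_cong:
  assumes "open S" "\<And>x. x \<in> S \<Longrightarrow> F x = G x" "ck_on k S F"
  shows "ck_on k S G"
  using assms(2,3)
proof (induction k arbitrary: F G)
  case 0
  then show ?case by (metis ck_on.simps(1) continuous_on_cong)
next
  case (Suc k)
  have "G differentiable at x" if "x \<in> S" for x
    using Suc.prems that assms(1)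
    by (metis ck_on.simps(2) differentiable_def has_derivative_transform_within_open)
  moreover have "frechet_derivative F (at x) v = frechet_derivative G (at x) v" if "x \<in> S" for x v
    using frechet_derivative_transform_within_open[of F x S G] Suc.prems that assms(1) by auto
  ultimately show ?case
    using Suc.prems(2) Suc.IH[of "\<lambda>x. frechet_derivative F (at x) v" "\<lambda>x. frechet_derivative G (at x) v"
        for v]
    by simp
qed

lemma ck_on_subset: "ck_on k S F \<Longrightarrow> T \<subseteq> S \<Longrightarrow> ck_on k T F"
  by (induction k arbitrary: F) (auto intro: continuous_on_subset)

lemma ck_on_Union:
  assumes "\<And>S. S \<in> \<C> \<Longrightarrow> open S" "\<And>S. S \<in> \<C> \<Longrightarrow> ck_on k S F"
  shows "ck_on k (\<Union>\<C>) F"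
  using assms(2)
proof (induction k arbitrary: F)
  case 0
  then show ?case using assms(1) by (auto intro: continuous_on_open_Union)
qed auto

lemma ck_on_const: "ck_on k S (\<lambda>_. c)"
  by (induction k arbitrary: c) auto

text \<open>Any explicit derivative \<open>F'\<close> may stand in for
  \<open>frechet_derivative\<close>, so each closure property below reduces to a differentiation
  rule and an induction hypothesis for its terms.\<close>

lemma ck_on_SucI:
  assumes "open S" "\<And>x. x \<in> S \<Longrightarrow> (F has_derivative F' x) (at x)" "\<And>v. ck_on k S (\<lambda>x. F' x v)"
  shows "ck_on (Suc k) S F"
proof -
  have "frechet_derivative F (at x) v = F' x v" if "x \<in> S" for x v
    using assms(2)[OF that] frechet_derivative_at by metis
  then show ?thesis
    using assms by (auto intro!: ck_on_cong[OF \<open>open S\<close> _ assms(3)] differentiableI)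
qed

lemma ck_on_SucD:
  assumes "ck_on (Suc k) S F"
  shows "x \<in> S \<Longrightarrow> (F has_derivative frechet_derivative F (at x)) (at x)"
    and "ck_on k S (\<lambda>x. frechet_derivative F (at x) v)"
  using assms by (auto simp: frechet_derivative_works[symmetric])

lemma ck_on_bounded_linear:
  assumes "bounded_linear h" "open S" "ck_on k S F"
  shows "ck_on k S (\<lambda>x. h (F x))"
  using assms(3)
proof (induction k arbitrary: F)
  case 0
  then show ?case
    using bounded_linear.continuous_on[OF assms(1)] by auto
next
  case (Suc k)
  note D = ck_on_SucD[OF Suc.prems]
  show ?case
    by (rule ck_on_SucI[OF assms(2) bounded_linear.has_derivative[OF assms(1) D(1)] Suc.IH[OF D(2)]])
qed

lemma ck_on_add:
  assumes "open S" "ck_on k S F" "ck_on k S G"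
  shows "ck_on k S (\<lambda>x. F x + G x)"
  using assms(2,3)
proof (induction k arbitrary: F G)
  case (Suc k)
  note D = ck_on_SucD[OF Suc.prems(1)] and D' = ck_on_SucD[OF Suc.prems(2)]
  show ?case
    by (rule ck_on_SucI[OF assms(1) has_derivative_add[OF D(1) D'(1)] Suc.IH[OF D(2) D'(2)]])
qed (auto intro: continuous_intros)

lemma ck_on_sum:
  assumes "open S" "\<And>i. i \<in> I \<Longrightarrow> ck_on k S (F i)"
  shows "ck_on k S (\<lambda>x. \<Sum>i\<in>I. F i x)"
  using assms(2) by (induction I rule: infinite_finite_induct) (auto intro: ck_on_const ck_on_add[OF assms(1)])

lemma ck_on_bounded_bilinear:
  assumes "bounded_bilinear h" "open S" "ck_on k S F" "ck_on k S G"
  shows "ck_on k S (\<lambda>x. h (F x) (G x))"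
  using assms(3,4)
proof (induction k arbitrary: F G)
  case 0
  then show ?case
    using bounded_bilinear.continuous_on[OF assms(1)] by auto
next
  case (Suc k)
  note D = ck_on_SucD[OF Suc.prems(1)] and D' = ck_on_SucD[OF Suc.prems(2)]
  show ?case
    by (rule ck_on_SucI[OF assms(2) bounded_bilinear.FDERIV[OF assms(1) D(1) D'(1)]
          ck_on_add[OF assms(2) Suc.IH[OF Suc.prems(1)[THEN ck_on_Suc_imp_ck_on] D'(2)]
            Suc.IH[OF D(2) Suc.prems(2)[THEN ck_on_Suc_imp_ck_on]]]])
qed

lemma ck_on_compose:
  fixes F :: "'a::euclidean_space \<Rightarrow> 'b::real_normed_vector"
  assumes "open S" "G ` S \<subseteq> T" "ck_on k T F" "ck_on k S G"
  shows "ck_on k S (\<lambda>x. F (G x))"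
  using assms(3,4)
proof (induction k arbitrary: F)
  case 0
  then show ?case using assms(2) continuous_on_compose2 by auto
next
  case (Suc k)
  note D = ck_on_SucD[OF Suc.prems(1)] and D' = ck_on_SucD[OF Suc.prems(2)]
  \<comment> \<open>The direction in which F is differentiated moves with x, whereas
    \<open>ck_on\<close> controls derivatives in fixed directions only. Expanding it in
    \<open>Basis\<close> separates the two dependences; this is where the domain of F has to be
    Euclidean.\<close>
  have *: "((\<lambda>x. F (G x)) has_derivative
      (\<lambda>v. \<Sum>b\<in>Basis. (frechet_derivative G (at x) v \<bullet> b) *\<^sub>R frechet_derivative F (at (G x)) b)) (at x)"
    if "x \<in> S" for x
  proof -
    have F: "(F has_derivative frechet_derivative F (at (G x))) (at (G x))"
      using D(1) assms(2) that by blast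
    have lin: "linear (frechet_derivative F (at (G x)))"
      using F by (rule has_derivative_linear)
    have rep: "(\<Sum>b\<in>Basis. (u \<bullet> b) *\<^sub>R frechet_derivative F (at (G x)) b) =
        frechet_derivative F (at (G x)) u" for u
    proof -
      have "frechet_derivative F (at (G x)) (\<Sum>b\<in>Basis. (u \<bullet> b) *\<^sub>R b) =
          (\<Sum>b\<in>Basis. (u \<bullet> b) *\<^sub>R frechet_derivative F (at (G x)) b)"
        by (simp only: linear_sum[OF lin] linear_scale[OF lin])
      then show ?thesis by (simp only: euclidean_representation)
    qed
    show ?thesis
      unfolding rep by (rule has_derivative_compose[OF D'(1)[OF that] F])
  qed
  show ?case
    by (rule ck_on_SucI[OF assms(1) *])
       (auto intro!: ck_on_sum[OF assms(1)] ck_on_bounded_bilinear[OF bounded_bilinear_scaleR assms(1)]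
          ck_on_bounded_linear[OF bounded_linear_inner_left assms(1)] D' Suc.IH D Suc.prems(2)[THEN ck_on_Suc_imp_ck_on])
qed

section \<open>Reciprocals and continuous square roots\<close>

lemma ck_on_inverse:
  fixes F :: "'a::real_normed_vector \<Rightarrow> 'b::real_normed_field"
  assumes "open S" "ck_on k S F" "\<And>x. x \<in> S \<Longrightarrow> F x \<noteq> 0"
  shows "ck_on k S (\<lambda>x. inverse (F x))"
  using assms(2)
proof (induction k)
  case 0
  then show ?case using assms(3) by (auto intro: continuous_intros)
next
  case (Suc k)
  note D = ck_on_SucD[OF Suc.prems(1)] and IH = Suc.IH[OF Suc.prems[THEN ck_on_Suc_imp_ck_on]]
  have *: "((\<lambda>x. inverse (F x)) has_derivative
      (\<lambda>v. - (inverse (F x) * frechet_derivative F (at x) v * inverse (F x)))) (at x)" if "x \<in> S" for x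
    using Deriv.has_derivative_inverse[OF assms(3)[OF that] D(1)[OF that]] .
  show ?case
    by (rule ck_on_SucI[OF assms(1) *])
       (auto intro!: ck_on_bounded_linear[OF bounded_linear_minus[OF bounded_linear_ident] assms(1)] 
         ck_on_bounded_bilinear[OF bounded_bilinear_mult assms(1)] IH D)
qed

text \<open>Near x the quotient w y / w x has positive real part, hence is the principal root of g y
  / g x. Dividing by g x moves the argument to 1, away from the branch cut of \<open>csqrt\<close>,
  so w locally equals w x times a differentiable function.\<close>

lemma has_derivative_continuous_sqrt:
  fixes w :: "'a::real_normed_vector \<Rightarrow> complex"
  assumes "open S" "continuous_on S w" "\<And>y. y \<in> S \<Longrightarrow> (w y)\<^sup>2 = g y" "x \<in> S" "w x \<noteq> 0"
    and g: "(g has_derivative g') (at x)"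
  shows "(w has_derivative (\<lambda>v. g' v / (2 * w x))) (at x)"
proof -
  have cont: "((\<lambda>y. Re (w y / w x)) \<longlongrightarrow> Re (w x / w x)) (at x)"
    using assms(1,2,4) by (intro tendsto_Re tendsto_divide[OF _ tendsto_const assms(5)])
      (auto simp: continuous_on_eq_continuous_at isCont_def)
  have "\<forall>\<^sub>F y in at x. 0 < Re (w y / w x)"
    by (rule order_tendstoD(1)[OF cont]) (use assms(5) in simp)
  moreover have "\<forall>\<^sub>F y in at x. y \<in> S"
    using assms(1,4) by (simp add: eventually_at_in_open')
  ultimately have ev: "\<forall>\<^sub>F y in at x. w x * csqrt (g y / g x) = w y"
  proof eventually_elim
    case (elim y)
    then have "g y / g x = (w y / w x)\<^sup>2"
      using assms(3,4) by (simp add: power_divide)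
    then show ?case
      using csqrt_square[of "w y / w x"] elim assms(5) by simp
  qed
  have gx: "g x = (w x)\<^sup>2" "g x \<noteq> 0" using assms(3)[OF assms(4), symmetric] assms(5) by auto
  have "(csqrt has_derivative (\<lambda>h. h * (1 / (2 * csqrt (g x / g x))))) (at (g x / g x))"
    using has_field_derivative_csqrt[of "g x / g x"] gx(2)
    by (simp add: has_field_derivative_def complex_nonpos_Reals_iff has_derivative_eq_rhs[of csqrt "(*) (1 / 2)"] fun_eq_iff)
  moreover have "((\<lambda>y. g y / g x) has_derivative (\<lambda>v. g' v / g x)) (at x)"
    using bounded_linear.has_derivative[OF bounded_linear_divide g] .
  ultimately have "((\<lambda>y. csqrt (g y / g x)) has_derivative (\<lambda>v. g' v / g x * (1 / (2 * csqrt (g x / g x))))) (at x)"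
    using has_derivative_compose by blast
  then have "((\<lambda>y. w x * csqrt (g y / g x)) has_derivative (\<lambda>v. w x * (g' v / g x * (1 / (2 * csqrt (g x / g x)))))) (at x)"
    by (rule has_derivative_mult_right)
  moreover have "w x * (g' v / g x * (1 / (2 * csqrt (g x / g x)))) = g' v / (2 * w x)" for v
    using gx assms(5) by (simp add: power2_eq_square)
  ultimately have "((\<lambda>y. w x * csqrt (g y / g x)) has_derivative (\<lambda>v. g' v / (2 * w x))) (at x)"
    by simp
  then show ?thesis
    by (rule has_derivative_transform_eventually[OF _ ev]) (use gx in auto)
qed

text \<open>Bootstrapping: the derivative g' / (2 w) contains w itself, so each order of
  differentiability of w yields the next.\<close>

lemma ck_on_continuous_sqrt:
  fixes w :: "'a::real_normed_vector \<Rightarrow> complex"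
  assumes "open S" "continuous_on S w" "\<And>x. x \<in> S \<Longrightarrow> (w x)\<^sup>2 = g x" "\<And>x. x \<in> S \<Longrightarrow> w x \<noteq> 0"
    and "ck_on k S g"
  shows "ck_on k S w"
  using assms(5)
proof (induction k)
  case (Suc k)
  note D = ck_on_SucD[OF Suc.prems(1)] and IH = Suc.IH[OF Suc.prems[THEN ck_on_Suc_imp_ck_on]]
  have *: "(w has_derivative (\<lambda>v. frechet_derivative g (at x) v / (2 * w x))) (at x)" if "x \<in> S" for x
    using has_derivative_continuous_sqrt[OF assms(1-3) that assms(4)[OF that] D(1)[OF that]] .
  show ?case
  proof (rule ck_on_SucI[OF assms(1) *])
    fix v
    have "ck_on k S (\<lambda>x. 2 * w x)"
      by (rule ck_on_bounded_bilinear[OF bounded_bilinear_mult assms(1) ck_on_const IH])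
    then have "ck_on k S (\<lambda>x. inverse (2 * w x))"
      by (rule ck_on_inverse[OF assms(1)]) (simp add: assms(4))
    then show "ck_on k S (\<lambda>x. frechet_derivative g (at x) v / (2 * w x))"
      unfolding divide_inverse by (rule ck_on_bounded_bilinear[OF bounded_bilinear_mult assms(1) D(2)])
  qed
qed (simp add: assms(2))

lemma smooth_on_cong: "open S \<Longrightarrow> (\<And>x. x \<in> S \<Longrightarrow> F x = G x) \<Longrightarrow> smooth_on S F \<Longrightarrow> smooth_on S G"
  unfolding smooth_on_def using ck_on_cong by blast

lemma smooth_on_subset: "smooth_on S F \<Longrightarrow> T \<subseteq> S \<Longrightarrow> smooth_on T F"
  unfolding smooth_on_def using ck_on_subset by blast

lemma smooth_on_Union:
  "(\<And>S. S \<in> \<C> \<Longrightarrow> open S) \<Longrightarrow> (\<And>S. S \<in> \<C> \<Longrightarrow> smooth_on S F) \<Longrightarrow> smooth_on (\<Union>\<C>) F"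
  unfolding smooth_on_def using ck_on_Union by blast

lemma smooth_on_const [simp]: "smooth_on S (\<lambda>_. c)"
  unfolding smooth_on_def by (simp add: ck_on_const)

lemma smooth_on_has_derivative:
  assumes "smooth_on S F" "x \<in> S"
  shows "(F has_derivative frechet_derivative F (at x)) (at x)"
  using assms ck_on_SucD(1) unfolding smooth_on_def by blast

lemma smooth_on_frechet_derivative: "smooth_on S F \<Longrightarrow> smooth_on S (\<lambda>x. frechet_derivative F (at x) v)"
  unfolding smooth_on_def using ck_on_SucD(2) by blast

lemma smooth_on_continuous_on: "smooth_on S F \<Longrightarrow> continuous_on S F"
  unfolding smooth_on_def using ck_on.simps(1) by blast

lemma smooth_on_bounded_linear:
  "bounded_linear h \<Longrightarrow> open S \<Longrightarrow> smooth_on S F \<Longrightarrow> smooth_on S (\<lambda>x. h (F x))"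
  unfolding smooth_on_def using ck_on_bounded_linear by blast

lemma smooth_on_add:
  "open S \<Longrightarrow> smooth_on S F \<Longrightarrow> smooth_on S G \<Longrightarrow> smooth_on S (\<lambda>x. F x + G x)"
  unfolding smooth_on_def using ck_on_add by blast

lemma smooth_on_minus: "open S \<Longrightarrow> smooth_on S F \<Longrightarrow> smooth_on S (\<lambda>x. - F x)"
  by (rule smooth_on_bounded_linear[OF bounded_linear_minus[OF bounded_linear_ident]])

lemma smooth_on_diff:
  "open S \<Longrightarrow> smooth_on S F \<Longrightarrow> smooth_on S G \<Longrightarrow> smooth_on S (\<lambda>x. F x - G x)"
  using smooth_on_add[of S F "\<lambda>x. - G x"] by (simp add: smooth_on_minus)

lemma smooth_on_sum:
  "open S \<Longrightarrow> (\<And>i. i \<in> I \<Longrightarrow> smooth_on S (F i)) \<Longrightarrow> smooth_on S (\<lambda>x. \<Sum>i\<in>I. F i x)"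
  unfolding smooth_on_def by (simp add: ck_on_sum)

lemma smooth_on_bounded_bilinear:
  "bounded_bilinear h \<Longrightarrow> open S \<Longrightarrow> smooth_on S F \<Longrightarrow> smooth_on S G \<Longrightarrow> smooth_on S (\<lambda>x. h (F x) (G x))"
  unfolding smooth_on_def using ck_on_bounded_bilinear by blast

lemmas smooth_on_mult = smooth_on_bounded_bilinear[OF bounded_bilinear_mult]
lemmas smooth_on_scaleR = smooth_on_bounded_bilinear[OF bounded_bilinear_scaleR]
lemmas smooth_on_inner = smooth_on_bounded_bilinear[OF bounded_bilinear_inner]

lemma smooth_on_compose:
  fixes F :: "'a::euclidean_space \<Rightarrow> 'b::real_normed_vector"
  shows "open S \<Longrightarrow> G ` S \<subseteq> T \<Longrightarrow> smooth_on T F \<Longrightarrow> smooth_on S G \<Longrightarrow> smooth_on S (\<lambda>x. F (G x))"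
  unfolding smooth_on_def using ck_on_compose by blast

lemma smooth_on_inverse:
  fixes F :: "'a::real_normed_vector \<Rightarrow> 'b::real_normed_field"
  shows "open S \<Longrightarrow> smooth_on S F \<Longrightarrow> (\<And>x. x \<in> S \<Longrightarrow> F x \<noteq> 0) \<Longrightarrow> smooth_on S (\<lambda>x. inverse (F x))"
  unfolding smooth_on_def using ck_on_inverse by blast

lemma smooth_on_divide:
  fixes F :: "'a::real_normed_vector \<Rightarrow> 'b::real_normed_field"
  shows "open S \<Longrightarrow> smooth_on S F \<Longrightarrow> smooth_on S G \<Longrightarrow> (\<And>x. x \<in> S \<Longrightarrow> G x \<noteq> 0) \<Longrightarrow> smooth_on S (\<lambda>x. F x / G x)"
  by (simp add: divide_inverse smooth_on_mult smooth_on_inverse)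

lemma smooth_on_continuous_sqrt:
  fixes w :: "'a::real_normed_vector \<Rightarrow> complex"
  shows "open S \<Longrightarrow> continuous_on S w \<Longrightarrow> (\<And>x. x \<in> S \<Longrightarrow> (w x)\<^sup>2 = g x) \<Longrightarrow> (\<And>x. x \<in> S \<Longrightarrow> w x \<noteq> 0) \<Longrightarrow>
    smooth_on S g \<Longrightarrow> smooth_on S w"
  unfolding smooth_on_def using ck_on_continuous_sqrt by blast

section \<open>Smoothness through components\<close>

lemma bounded_linear_axis: "bounded_linear (\<lambda>x. axis i x :: 'b::real_normed_vector^'n)"
proof (rule bounded_linear_intro)
  have "(norm (axis i x $ j :: 'b))\<^sup>2 = (if j = i then (norm x)\<^sup>2 else 0)" for x j
    by (simp add: axis_def)
  then show "norm (axis i x :: 'b^'n) \<le> norm x * 1" for x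
    by (simp add: norm_vec_def L2_set_def)
qed (auto simp: axis_def vec_eq_iff)

lemma smooth_on_vec:
  fixes F :: "'a::real_normed_vector \<Rightarrow> 'b::real_normed_vector^'n"
  assumes "open S" "\<And>i. smooth_on S (\<lambda>x. F x $ i)"
  shows "smooth_on S F"
proof -
  have "(\<Sum>i\<in>UNIV. axis i (F x $ i)) = F x" for x
    by (simp add: vec_eq_iff axis_def if_distrib cong: if_cong)
  moreover have "smooth_on S (\<lambda>x. \<Sum>i\<in>UNIV. axis i (F x $ i))"
    by (intro smooth_on_sum assms smooth_on_bounded_linear[OF bounded_linear_axis])
  ultimately show ?thesis by simp
qed

lemma smooth_on_vec_nth:
  "open S \<Longrightarrow> smooth_on S F \<Longrightarrow> smooth_on S (\<lambda>x. F x $ i)"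
  by (rule smooth_on_bounded_linear[OF bounded_linear_vec_nth])

lemma frechet_derivative_eqI: "(F has_derivative F') (at x) \<Longrightarrow> frechet_derivative F (at x) = F'"
  using frechet_derivative_at by metis

lemma smooth_on_linear_frechet_derivative:
  "smooth_on S F \<Longrightarrow> x \<in> S \<Longrightarrow> linear (frechet_derivative F (at x))"
  using smooth_on_has_derivative has_derivative_linear by blast

text \<open>Schwarz's theorem. The second difference over the parallelogram with sides e v and e w
  is symmetric in v and w; it equals e^2 times either mixed derivative at some point close to p, and
  both mixed derivatives are continuous.\<close>

lemma symmetric_frechet_derivative_real:
  fixes F :: "'a::real_normed_vector \<Rightarrow> real"
  assumes "open S" "ck_on 2 S F" "p \<in> S"
  shows "frechet_derivative (\<lambda>x. frechet_derivative F (at x) v) (at p) w =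
         frechet_derivative (\<lambda>x. frechet_derivative F (at x) w) (at p) v"
proof (cases "v = 0 \<or> w = 0")
  case True
  have "linear (frechet_derivative F (at x))" if "x \<in> S" for x
    using assms(2) that ck_on_SucD(1)[of 1 S F x] has_derivative_linear by (auto simp: numeral_2_eq_2)
  then have "frechet_derivative (\<lambda>x. frechet_derivative F (at x) 0) (at p) = (\<lambda>_. 0)"
    using frechet_derivative_transform_within_open[of "\<lambda>_. 0" p S "\<lambda>x. frechet_derivative F (at x) 0"] assms
    by (simp add: linear_0)
  moreover have "linear (frechet_derivative (\<lambda>x. frechet_derivative F (at x) u) (at p))" for u
    using assms(2,3) ck_on_SucD(1)[of 0 S "\<lambda>x. frechet_derivative F (at x) u" p] has_derivative_linear
    by (auto simp: numeral_2_eq_2)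
  ultimately show ?thesis
    using True by (auto simp: linear_0)
next
  case False
  define D where "D u x = frechet_derivative F (at x) u" for u x
  define E where "E u u' x = frechet_derivative (D u) (at x) u'" for u u' x
  have D: "(F has_derivative (\<lambda>u. D u x)) (at x)" if "x \<in> S" for x
    using ck_on_SucD(1)[of 1 S F x] assms(2) that by (simp add: D_def[abs_def] numeral_2_eq_2)
  have E: "(D u has_derivative (\<lambda>u'. E u u' x)) (at x)" if "x \<in> S" for u x
    using ck_on_SucD(1)[of 0 S "D u" x] ck_on_SucD(2)[of 1 S F u] assms(2) that
    by (simp add: D_def[abs_def] E_def[abs_def] numeral_2_eq_2)
  have contE: "continuous_on S (E u u')" for u u'
    using ck_on_SucD(2)[of 0 S "D u" u'] ck_on_SucD(2)[of 1 S F u] assms(2)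
    by (simp add: D_def[abs_def] E_def[abs_def] numeral_2_eq_2)
  \<comment> \<open>the mean value theorem, first in direction \<open>u\<close>, then in direction \<open>u'\<close>\<close>
  have second_difference: "\<exists>s t. 0 < s \<and> s < e \<and> 0 < t \<and> t < e \<and>
      F (p + e *\<^sub>R u + e *\<^sub>R u') - F (p + e *\<^sub>R u) - F (p + e *\<^sub>R u') + F p =
      e * e * E u u' (p + s *\<^sub>R u + t *\<^sub>R u')"
    if "e > 0" and S: "\<And>s t. 0 \<le> s \<Longrightarrow> s \<le> e \<Longrightarrow> 0 \<le> t \<Longrightarrow> t \<le> e \<Longrightarrow> p + s *\<^sub>R u + t *\<^sub>R u' \<in> S"
    for e u u'
  proof -
    define f where "f s = F (p + s *\<^sub>R u + e *\<^sub>R u') - F (p + s *\<^sub>R u)" for s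
    have line: "((\<lambda>s. a + s *\<^sub>R b) has_derivative (\<lambda>h. h *\<^sub>R b)) (at s)" for a b :: 'a and s
      by (auto intro!: derivative_eq_intros)
    have f': "(f has_real_derivative D u (p + s *\<^sub>R u + e *\<^sub>R u') - D u (p + s *\<^sub>R u)) (at s)"
      if "0 \<le> s" "s \<le> e" for s
    proof -
      have 1: "((\<lambda>s. F ((p + e *\<^sub>R u') + s *\<^sub>R u)) has_derivative
          (\<lambda>h. D (h *\<^sub>R u) (p + e *\<^sub>R u' + s *\<^sub>R u))) (at s)"
        by (rule has_derivative_compose[OF line D]) (use S[of s e] that \<open>e > 0\<close> in \<open>simp add: algebra_simps\<close>)
      have 2: "((\<lambda>s. F (p + s *\<^sub>R u)) has_derivative (\<lambda>h. D (h *\<^sub>R u) (p + s *\<^sub>R u))) (at s)"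
        by (rule has_derivative_compose[OF line D]) (use S[of s 0] that \<open>e > 0\<close> in simp)
      have lin: "D (h *\<^sub>R u) x = h * D u x" if "x \<in> S" for x h
        using linear_scale[OF has_derivative_linear[OF D[OF that]]] by simp
      have "(f has_derivative (\<lambda>h. D (h *\<^sub>R u) (p + e *\<^sub>R u' + s *\<^sub>R u) - D (h *\<^sub>R u) (p + s *\<^sub>R u))) (at s)"
        using has_derivative_diff[OF 1 2] by (simp add: f_def[abs_def] add_ac)
      moreover have "D (h *\<^sub>R u) (p + e *\<^sub>R u' + s *\<^sub>R u) - D (h *\<^sub>R u) (p + s *\<^sub>R u) =
          (D u (p + s *\<^sub>R u + e *\<^sub>R u') - D u (p + s *\<^sub>R u)) * h" for h
      proof -
        have "p + e *\<^sub>R u' + s *\<^sub>R u \<in> S" "p + s *\<^sub>R u \<in> S"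
          using S[of s e] S[of s 0] that \<open>e > 0\<close> by (simp_all add: add_ac)
        moreover have "p + e *\<^sub>R u' + s *\<^sub>R u = p + s *\<^sub>R u + e *\<^sub>R u'"
          by simp
        ultimately show ?thesis
          by (simp only: lin left_diff_distrib right_diff_distrib mult.commute)
      qed
      ultimately show ?thesis
        by (simp add: has_field_derivative_def)
    qed
    then obtain s where s: "0 < s" "s < e"
        "f e - f 0 = (e - 0) * (D u (p + s *\<^sub>R u + e *\<^sub>R u') - D u (p + s *\<^sub>R u))"
      using MVT2[OF \<open>e > 0\<close> f'] by (auto simp only:)
    have D': "((\<lambda>t. D u (p + s *\<^sub>R u + t *\<^sub>R u')) has_real_derivative E u u' (p + s *\<^sub>R u + t *\<^sub>R u')) (at t)"
      if "0 \<le> t" "t \<le> e" for t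
    proof -
      have inS: "p + s *\<^sub>R u + t *\<^sub>R u' \<in> S"
        using S[of s t] s that by simp
      have "((\<lambda>t. D u ((p + s *\<^sub>R u) + t *\<^sub>R u')) has_derivative (\<lambda>h. E u (h *\<^sub>R u') (p + s *\<^sub>R u + t *\<^sub>R u'))) (at t)"
        by (rule has_derivative_compose[OF line E]) (use inS in simp)
      moreover have "E u (h *\<^sub>R u') (p + s *\<^sub>R u + t *\<^sub>R u') = E u u' (p + s *\<^sub>R u + t *\<^sub>R u') * h" for h
        using linear_scale[OF has_derivative_linear[OF E[OF inS]]] by (simp add: mult.commute)
      ultimately show ?thesis
        by (simp add: has_field_derivative_def)
    qed
    then obtain t where t: "0 < t" "t < e"
      "D u (p + s *\<^sub>R u + e *\<^sub>R u') - D u (p + s *\<^sub>R u + 0 *\<^sub>R u') =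
        (e - 0) * E u u' (p + s *\<^sub>R u + t *\<^sub>R u')"
      using MVT2[OF \<open>e > 0\<close> D'] by (auto simp only:)
    show ?thesis
      by (rule exI[of _ s], rule exI[of _ t]) (use s t in \<open>simp add: f_def\<close>)
  qed
  have "E v w p - E w v p = 0"
  proof (rule ccontr)
    assume neq: "E v w p - E w v p \<noteq> 0"
    \<comment> \<open>Half of the supposed gap: two equal numbers cannot lie within less than d of
      its two ends.\<close>
    define d where "d = \<bar>E v w p - E w v p\<bar> / 2"
    have "d > 0" using neq by (simp add: d_def)
    have "\<exists>r>0. \<forall>x. dist x p < r \<longrightarrow> x \<in> S \<and> \<bar>E u u' x - E u u' p\<bar> < d" for u u'
    proof -
      obtain r1 where r1: "r1 > 0" "ball p r1 \<subseteq> S"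
        using assms(1,3) by (auto simp: open_contains_ball)
      obtain r2 where "r2 > 0" "\<And>x. x \<in> S \<Longrightarrow> dist x p < r2 \<Longrightarrow> dist (E u u' x) (E u u' p) < d"
        using contE[of u u'] assms(3) \<open>d > 0\<close> unfolding continuous_on_iff by metis
      then show ?thesis
        using r1 by (intro exI[of _ "min r1 r2"]) (auto simp: dist_real_def dist_commute subset_iff)
    qed
    then obtain r1 r2 where r: "r1 > 0" "r2 > 0"
      "\<And>x. dist x p < r1 \<Longrightarrow> x \<in> S \<and> \<bar>E v w x - E v w p\<bar> < d"
      "\<And>x. dist x p < r2 \<Longrightarrow> x \<in> S \<and> \<bar>E w v x - E w v p\<bar> < d"
      by meson
    \<comment> \<open>Small enough to keep the whole parallelogram in the ball where both mixed
      derivatives stay within d of their values at p.\<close>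
    define e where "e = min r1 r2 / (2 * (norm v + norm w))"
    have nvw: "norm v + norm w > 0"
      using False by (simp add: add_pos_pos)
    then have "e > 0" using r by (simp add: e_def)
    have near: "dist (p + s *\<^sub>R v + t *\<^sub>R w) p < min r1 r2" if "0 \<le> s" "s \<le> e" "0 \<le> t" "t \<le> e" for s t
    proof -
      have "dist (p + s *\<^sub>R v + t *\<^sub>R w) p \<le> s * norm v + t * norm w"
        using norm_triangle_ineq[of "s *\<^sub>R v" "t *\<^sub>R w"] that by (simp add: dist_norm)
      also have "\<dots> \<le> e * (norm v + norm w)"
        using that by (simp add: distrib_left add_mono mult_right_mono)
      also have "\<dots> = min r1 r2 / 2"
        using nvw by (simp add: e_def divide_simps)
      also have "\<dots> < min r1 r2"
        using r(1,2) by linarith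
      finally show ?thesis .
    qed
    then obtain s t where st: "0 < s" "s < e" "0 < t" "t < e"
      "F (p + e *\<^sub>R v + e *\<^sub>R w) - F (p + e *\<^sub>R v) - F (p + e *\<^sub>R w) + F p =
        e * e * E v w (p + s *\<^sub>R v + t *\<^sub>R w)"
      using second_difference[OF \<open>e > 0\<close>, of v w] r by fastforce
    have "p + s *\<^sub>R w + t *\<^sub>R v \<in> S" if "0 \<le> s" "s \<le> e" "0 \<le> t" "t \<le> e" for s t
      using near[of t s] r that by (simp add: add_ac)
    then obtain s' t' where st': "0 < s'" "s' < e" "0 < t'" "t' < e"
      "F (p + e *\<^sub>R w + e *\<^sub>R v) - F (p + e *\<^sub>R w) - F (p + e *\<^sub>R v) + F p =
        e * e * E w v (p + s' *\<^sub>R w + t' *\<^sub>R v)"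
      using second_difference[OF \<open>e > 0\<close>, of w v] by blast
    have "e * e * E v w (p + s *\<^sub>R v + t *\<^sub>R w) = e * e * E w v (p + s' *\<^sub>R w + t' *\<^sub>R v)"
      using st(5) st'(5)[unfolded add.assoc[of p "e *\<^sub>R w"] add.commute[of "e *\<^sub>R w"], folded add.assoc]
      by linarith
    then have "E v w (p + s *\<^sub>R v + t *\<^sub>R w) = E w v (p + s' *\<^sub>R w + t' *\<^sub>R v)"
      using \<open>e > 0\<close> by simp
    moreover have "\<bar>E v w (p + s *\<^sub>R v + t *\<^sub>R w) - E v w p\<bar> < d"
      using r(3) near[of s t] st by simp
    moreover have "\<bar>E w v (p + s' *\<^sub>R w + t' *\<^sub>R v) - E w v p\<bar> < d"
      using r(4) near[of t' s'] st' by (simp add: add_ac)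
    ultimately show False
      unfolding d_def by (simp add: abs_if field_simps split: if_splits)
  qed
  then show ?thesis
    by (simp add: E_def D_def[abs_def])
qed

lemma symmetric_frechet_derivative:
  fixes F :: "'a::real_normed_vector \<Rightarrow> 'b::euclidean_space"
  assumes "open S" "smooth_on S F" "p \<in> S"
  shows "frechet_derivative (\<lambda>x. frechet_derivative F (at x) v) (at p) w =
         frechet_derivative (\<lambda>x. frechet_derivative F (at x) w) (at p) v"
proof (rule euclidean_eqI)
  fix b :: 'b assume "b \<in> Basis"
  have D: "frechet_derivative (\<lambda>x. F x \<bullet> b) (at x) u = frechet_derivative F (at x) u \<bullet> b"
    if "x \<in> S" and "smooth_on S F" for F :: "'a \<Rightarrow> 'b" and x u
    using frechet_derivative_eqI[OF bounded_linear.has_derivative[OF bounded_linear_inner_left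
          smooth_on_has_derivative[OF that(2,1)]], of b] by simp
  have DD: "frechet_derivative (\<lambda>x. frechet_derivative (\<lambda>x. F x \<bullet> b) (at x) u) (at p) u' =
      frechet_derivative (\<lambda>x. frechet_derivative F (at x) u) (at p) u' \<bullet> b" for u u'
  proof -
    note sm = smooth_on_frechet_derivative[OF assms(2), of u]
    have "((\<lambda>x. frechet_derivative F (at x) u \<bullet> b) has_derivative
        (\<lambda>u'. frechet_derivative (\<lambda>x. frechet_derivative F (at x) u) (at p) u' \<bullet> b)) (at p)"
      by (rule bounded_linear.has_derivative[OF bounded_linear_inner_left smooth_on_has_derivative[OF sm assms(3)]])
    then have "((\<lambda>x. frechet_derivative (\<lambda>x. F x \<bullet> b) (at x) u) has_derivative
        (\<lambda>u'. frechet_derivative (\<lambda>x. frechet_derivative F (at x) u) (at p) u' \<bullet> b)) (at p)"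
      by (rule has_derivative_transform_within_open[OF _ assms(1,3)]) (simp add: D assms(2))
    from frechet_derivative_eqI[OF this] show ?thesis by simp
  qed
  have "smooth_on S (\<lambda>x. F x \<bullet> b)"
    by (rule smooth_on_bounded_linear[OF bounded_linear_inner_left assms(1,2)])
  then have "ck_on 2 S (\<lambda>x. F x \<bullet> b)"
    unfolding smooth_on_def by blast
  from symmetric_frechet_derivative_real[OF assms(1) this assms(3), of v w]
  show "frechet_derivative (\<lambda>x. frechet_derivative F (at x) v) (at p) w \<bullet> b =
      frechet_derivative (\<lambda>x. frechet_derivative F (at x) w) (at p) v \<bullet> b"
    unfolding DD .
qed

section \<open>Complex charts of an oriented surface\<close>

lemma contractible_top_connected:
  fixes S :: "'a::topological_space set"
  shows "contractible S \<Longrightarrow> connected S"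
  using contractible_imp_connected_space[of "top_of_set S"]
  by (simp add: connectedin_def[symmetric] flip: connectedin_topspace) 

lemma det_vector_2: "det (vector [a, b] :: real^2^2) = a $ 1 * b $ 2 - a $ 2 * b $ 1"
  by (simp add: det_2)

lemma linear_2_expansion:
  fixes f :: "real^2 \<Rightarrow> 'b::real_vector"
  assumes "linear f"
  shows "f x = x $ 1 *\<^sub>R f (axis 1 1) + x $ 2 *\<^sub>R f (axis 2 1)"
proof -
  have "x = x $ 1 *\<^sub>R axis 1 1 + x $ 2 *\<^sub>R axis 2 1"
    by (simp add: vec_eq_iff forall_2 axis_def)
  then have "f x = f (x $ 1 *\<^sub>R axis 1 1 + x $ 2 *\<^sub>R axis 2 1)" by simp
  then show ?thesis by (simp only: linear_add[OF assms] linear_scale[OF assms])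
qed

lemma det_vector_2_linear:
  fixes f :: "real^2 \<Rightarrow> real^2"
  assumes "linear f"
  shows "det (vector [f x, f y] :: real^2^2) = det (matrix f) * det (vector [x, y] :: real^2^2)"
proof -
  have "f x $ i = x $ 1 * matrix f $ i $ 1 + x $ 2 * matrix f $ i $ 2" for x i
    by (subst linear_2_expansion[OF assms]) (simp add: matrix_def)
  then show ?thesis
    unfolding det_vector_2 det_2 by (simp add: algebra_simps)
qed

text \<open>\<open>Im (cnj a * b)\<close> is the area form of the complex plane, the determinant of
  (a, b) in the basis 1, \<open>\<i>\<close>. A linear map multiplies areas by a constant, which is
  read off on the standard basis.\<close>

lemma Im_cnj_mult_linear:
  fixes f :: "real^2 \<Rightarrow> complex"
  assumes "linear f"
  shows "Im (cnj (f x) * f y) = Im (cnj (f (axis 1 1)) * f (axis 2 1)) * det (vector [x, y] :: real^2^2)"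
  unfolding det_vector_2 by (subst (1 2) linear_2_expansion[OF assms]) (simp add: algebra_simps)

text \<open>The purpose is to make z one coordinate for all of U, so that calculus on the surface
  becomes calculus on a plane domain.\<close>

locale positive_complex_chart =
  fixes A :: "'m::{t2_space,second_countable_topology} chart set"
    and U :: "'m set" and z :: "'m \<Rightarrow> complex"
  assumes surface: "oriented_surface A"
    and complex_chart: "complex_chart A U z"
    and positive: "\<And>q v w. q \<in> U \<Longrightarrow> pos_basis A q v w \<Longrightarrow> Im (cnj (tdiff A z q v) * tdiff A z q w) > 0"
begin

abbreviation "z_inv \<equiv> inv_into U z"

lemma open_U: "open U" and inj_z: "inj_on z U" and open_D: "open (z ` U)"
  using complex_chart by (auto simp: complex_chart_def)

lemma z_inv_z: "q \<in> U \<Longrightarrow> z_inv (z q) = q"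
  using inj_z by simp

lemma z_z_inv: "p \<in> z ` U \<Longrightarrow> z (z_inv p) = p"
  by (rule f_inv_into_f)

lemma z_inv_in: "p \<in> z ` U \<Longrightarrow> z_inv p \<in> U"
  by (rule inv_into_into)

context
  fixes c assumes c: "c \<in> A"
begin

lemma chart_homeomorphism:
  "homeomorphism (fst c) (snd c ` fst c) (snd c) (inv_into (fst c) (snd c))"
  and open_chart_domain: "open (fst c)" and open_chart_range: "open (snd c ` fst c)"
  using surface c unfolding oriented_surface_def by blast+

lemma chart_inv: "q \<in> fst c \<Longrightarrow> inv_into (fst c) (snd c) (snd c q) = q"
  using chart_homeomorphism unfolding homeomorphism_def by blast

lemma open_chart_image:
  assumes "open V"
  shows "open (snd c ` (fst c \<inter> V))"
proof -
  have "openin (top_of_set (fst c)) (fst c \<inter> V)"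
    using assms by (rule openin_open_Int)
  then have "openin (top_of_set (snd c ` fst c)) (snd c ` (fst c \<inter> V))"
    using homeomorphism_imp_open_map[OF chart_homeomorphism] by blast
  then show ?thesis
    using open_chart_range openin_open_trans by blast
qed

lemma smooth_z_chart: "smooth_on (snd c ` (fst c \<inter> U)) (coord_rep c z)"
  using complex_chart c by (auto simp: complex_chart_def smooth_map_def)

lemma smooth_chart_z: "smooth_on (z ` (U \<inter> fst c)) (snd c \<circ> z_inv)"
  using complex_chart c by (auto simp: complex_chart_def)

text \<open>\<open>complex_chart\<close> demands smoothness on such images without asking that they
  be open. Invariance of domain supplies this, since z read in the chart c is continuous and
  injective.\<close>

lemma open_z_image: "open V \<Longrightarrow> open (z ` (U \<inter> fst c \<inter> V))"
proof -
  assume "open V"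
  let ?W = "snd c ` (fst c \<inter> (U \<inter> V))"
  have "open ?W"
    by (rule open_chart_image) (use open_U \<open>open V\<close> in auto)
  moreover have "continuous_on ?W (coord_rep c z)"
    by (rule continuous_on_subset[OF smooth_on_continuous_on[OF smooth_z_chart]]) auto
  moreover have "inj_on (coord_rep c z) ?W"
    using inj_z by (auto simp: inj_on_def coord_rep_def chart_inv)
  ultimately have "open (coord_rep c z ` ?W)"
    by (rule invariance_of_domain_gen) simp
  moreover have "coord_rep c z ` ?W = z ` (U \<inter> fst c \<inter> V)"
    by (force simp: coord_rep_def chart_inv image_iff)
  ultimately show ?thesis by simp
qed

end

lemma Union_charts: "(\<Union>c\<in>A. fst c) = UNIV"
  using surface unfolding oriented_surface_def by blast

lemma exists_chart: "\<exists>c\<in>A. q \<in> fst c"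
  using Union_charts by blast

lemma continuous_z: "continuous_on U z"
proof -
  have "continuous_on (\<Union>c\<in>A. fst c \<inter> U) z"
  proof (rule continuous_on_open_UN)
    fix c assume c: "c \<in> A"
    show "open (fst c \<inter> U)" using open_chart_domain[OF c] open_U by auto
    have "continuous_on (fst c \<inter> U) (\<lambda>q. coord_rep c z (snd c q))"
      by (rule continuous_on_compose2[OF smooth_on_continuous_on[OF smooth_z_chart[OF c]]])
        (use chart_homeomorphism[OF c] in \<open>auto simp: homeomorphism_def intro: continuous_on_subset\<close>)
    then show "continuous_on (fst c \<inter> U) z"
      by (rule continuous_on_eq) (simp add: coord_rep_def chart_inv[OF c])
  qed
  then show ?thesis
    using Union_charts by (simp add: Int_UN_distrib2[symmetric] flip: UN_extend_simps) 
qed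

lemma D_eq_Union: "z ` U = \<Union>((\<lambda>c. z ` (U \<inter> fst c)) ` A)"
  using Union_charts by blast

lemma continuous_z_inv: "continuous_on (z ` U) z_inv"
proof -
  have "continuous_on (\<Union>c\<in>A. z ` (U \<inter> fst c)) z_inv"
  proof (rule continuous_on_open_UN)
    fix c assume c: "c \<in> A"
    show "open (z ` (U \<inter> fst c))" using open_z_image[OF c open_UNIV] by simp
    have "continuous_on (z ` (U \<inter> fst c)) (\<lambda>p. inv_into (fst c) (snd c) ((snd c \<circ> z_inv) p))"
      by (rule continuous_on_compose2[OF _ smooth_on_continuous_on[OF smooth_chart_z[OF c]], of "snd c ` fst c"])
        (use chart_homeomorphism[OF c] in \<open>auto simp: homeomorphism_def z_inv_z\<close>)
    then show "continuous_on (z ` (U \<inter> fst c)) z_inv"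
      by (rule continuous_on_eq) (auto simp: chart_inv[OF c] z_inv_z)
  qed
  then show ?thesis
    using D_eq_Union by simp
qed

text \<open>Brings contractibility to the plane, where it provides the continuous square
  root.\<close>

lemma contractible_D: "contractible U \<Longrightarrow> contractible (z ` U)"
proof -
  assume "contractible U"
  have "homeomorphic_maps (top_of_set U) (top_of_set (z ` U)) z z_inv"
    unfolding homeomorphic_maps_def
    using continuous_z continuous_z_inv by (auto simp: z_inv_z)
  then have "top_of_set U homeomorphic_space top_of_set (z ` U)"
    using homeomorphic_space_def by blast
  then show ?thesis
    using homeomorphic_space_contractibility[of "top_of_set U" "top_of_set (z ` U)"] \<open>contractible U\<close> by simp
qed

text \<open>Each direction composes with one of the two transitions between z and a chart.
  Smoothness is local, and the images of the chart domains form an open cover of the image of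
  U.\<close>

lemma smooth_map_iff: "smooth_map A U F \<longleftrightarrow> smooth_on (z ` U) (F \<circ> z_inv)"
proof
  assume L: "smooth_map A U F"
  have "smooth_on (\<Union>((\<lambda>c. z ` (U \<inter> fst c)) ` A)) (F \<circ> z_inv)"
  proof (rule smooth_on_Union; clarify)
    fix c assume c: "(c::'m chart) \<in> A"
    show op: "open (z ` (U \<inter> fst c))" using open_z_image[OF c open_UNIV] by simp
    have F: "smooth_on (snd c ` (fst c \<inter> U)) (coord_rep c F)"
      using L c by (auto simp: smooth_map_def)
    have "smooth_on (z ` (U \<inter> fst c)) (\<lambda>p. coord_rep c F ((snd c \<circ> z_inv) p))"
      using smooth_on_compose[OF op _ F smooth_chart_z[OF c]] by (auto simp: z_inv_z image_subset_iff)
    then show "smooth_on (z ` (U \<inter> fst c)) (F \<circ> z_inv)"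
      by (rule smooth_on_cong[OF op, rotated]) (auto simp: coord_rep_def chart_inv[OF c] z_inv_z)
  qed
  then show "smooth_on (z ` U) (F \<circ> z_inv)" using D_eq_Union by simp
next
  assume R: "smooth_on (z ` U) (F \<circ> z_inv)"
  show "smooth_map A U F"
    unfolding smooth_map_def
  proof
    fix c assume c: "c \<in> A"
    note op = open_chart_image[OF c open_U]
    have "smooth_on (snd c ` (fst c \<inter> U)) (\<lambda>x. (F \<circ> z_inv) (coord_rep c z x))"
      by (rule smooth_on_compose[OF op _ R smooth_z_chart[OF c]]) (auto simp: coord_rep_def chart_inv[OF c])
    then show "smooth_on (snd c ` (fst c \<inter> U)) (coord_rep c F)"
      by (rule smooth_on_cong[OF op, rotated]) (auto simp: coord_rep_def chart_inv[OF c] z_inv_z)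
  qed
qed

text \<open>The same choice as in \<open>tdiff\<close>, so that \<open>tdiff\<close> unfolds in a
  fixed chart and its independence of the chart need not be proved.\<close>

definition base_chart :: "'m \<Rightarrow> 'm chart" where
  "base_chart q = (SOME c. c \<in> charts_at A q)"

lemma base_chart: "base_chart q \<in> charts_at A q"
proof -
  obtain c where "c \<in> charts_at A q"
    using exists_chart[of q] by (auto simp: charts_at_def)
  then show ?thesis
    unfolding base_chart_def by (rule someI)
qed

lemma base_chart_in: "base_chart q \<in> A" "q \<in> fst (base_chart q)"
  using base_chart[of q] by (auto simp: charts_at_def)

lemma tdiff_eq: "tdiff A F q v =
    frechet_derivative (coord_rep (base_chart q) F) (at (snd (base_chart q) q)) (v (base_chart q))"
  by (simp add: tdiff_def base_chart_def Let_def)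

lemma z_chart_has_derivative:
  assumes "q \<in> U"
  shows "(coord_rep (base_chart q) z has_derivative
      frechet_derivative (coord_rep (base_chart q) z) (at (snd (base_chart q) q))) (at (snd (base_chart q) q))"
  by (rule smooth_on_has_derivative[OF smooth_z_chart]) (use base_chart_in[of q] assms in auto)

lemma linear_z_chart:
  "q \<in> U \<Longrightarrow> linear (frechet_derivative (coord_rep (base_chart q) z) (at (snd (base_chart q) q)))"
  by (rule has_derivative_linear[OF z_chart_has_derivative])

text \<open>Chain rule through z. A tangent vector enters any differential on U only through the
  complex number \<open>tdiff A z q v\<close>, which becomes the variable \<open>\<zeta>\<close> of
  the plane computations.\<close>

lemma tdiff_z_inv:
  assumes F: "smooth_map A U F" and q: "q \<in> U"
  shows "tdiff A F q v = frechet_derivative (F \<circ> z_inv) (at (z q)) (tdiff A z q v)"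
proof -
  let ?c = "base_chart q"
  note c = base_chart_in[of q]
  have zq: "coord_rep ?c z (snd ?c q) = z q"
    using chart_inv[OF c] by (simp add: coord_rep_def)
  have "((F \<circ> z_inv) has_derivative frechet_derivative (F \<circ> z_inv) (at (z q))) (at (coord_rep ?c z (snd ?c q)))"
    unfolding zq by (rule smooth_on_has_derivative) (use F q smooth_map_iff in auto)
  from has_derivative_compose[OF z_chart_has_derivative[OF q] this]
  have "((\<lambda>x. (F \<circ> z_inv) (coord_rep ?c z x)) has_derivative
      (\<lambda>u. frechet_derivative (F \<circ> z_inv) (at (z q)) (frechet_derivative (coord_rep ?c z) (at (snd ?c q)) u)))
      (at (snd ?c q))" .
  then have "(coord_rep ?c F has_derivative
      (\<lambda>u. frechet_derivative (F \<circ> z_inv) (at (z q)) (frechet_derivative (coord_rep ?c z) (at (snd ?c q)) u)))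
      (at (snd ?c q))"
    by (rule has_derivative_transform_within_open[OF _ open_chart_image[OF c(1) open_U]])
      (use c q in \<open>auto simp: coord_rep_def chart_inv z_inv_z\<close>)
  from frechet_derivative_eqI[OF this] show ?thesis
    unfolding tdiff_eq by simp
qed

definition transition :: "'m \<Rightarrow> 'm chart \<Rightarrow> 'm chart \<Rightarrow> real^2 \<Rightarrow> real^2" where
  "transition q c c' = frechet_derivative (coord_rep c (snd c')) (at (snd c q))"

lemma transition_has_derivative:
  assumes "c \<in> charts_at A q" "c' \<in> charts_at A q"
  shows "(coord_rep c (snd c') has_derivative transition q c c') (at (snd c q))"
  unfolding transition_def
  by (rule smooth_on_has_derivative[of "snd c ` (fst c \<inter> fst c')"])
    (use assms surface in \<open>auto simp: charts_at_def oriented_surface_def\<close>)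

lemma linear_transition:
  "c \<in> charts_at A q \<Longrightarrow> c' \<in> charts_at A q \<Longrightarrow> linear (transition q c c')"
  by (rule has_derivative_linear[OF transition_has_derivative])

lemma transition_det:
  assumes "c \<in> charts_at A q" "c' \<in> charts_at A q"
  shows "det (matrix (transition q c c')) > 0"
  using assms surface unfolding transition_def oriented_surface_def charts_at_def by blast

text \<open>The cocycle rule, from the chain rule; it is what makes \<open>tvec\<close> a compatible
  family.\<close>

lemma transition_trans:
  assumes c: "c \<in> charts_at A q" and c': "c' \<in> charts_at A q" and c'': "c'' \<in> charts_at A q"
  shows "transition q c' c'' (transition q c c' u) = transition q c c'' u"
proof -
  have q: "c \<in> A" "q \<in> fst c" "c' \<in> A" "q \<in> fst c'" using c c' by (auto simp: charts_at_def)
  have eq: "coord_rep c (snd c') (snd c q) = snd c' q"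
    by (simp add: coord_rep_def chart_inv q)
  have "((\<lambda>x. coord_rep c' (snd c'') (coord_rep c (snd c') x)) has_derivative
      (\<lambda>u. transition q c' c'' (transition q c c' u))) (at (snd c q))"
    by (rule has_derivative_compose[OF transition_has_derivative[OF c c']])
      (use transition_has_derivative[OF c' c''] eq in simp)
  then have "(coord_rep c (snd c'') has_derivative (\<lambda>u. transition q c' c'' (transition q c c' u))) (at (snd c q))"
    by (rule has_derivative_transform_within_open[OF _ open_chart_image[OF q(1) open_chart_domain[OF q(3)]]])
      (use q in \<open>auto simp: coord_rep_def chart_inv\<close>)
  from frechet_derivative_eqI[OF this] show ?thesis
    by (simp add: transition_def)
qed

lemma transition_refl:
  assumes c: "c \<in> charts_at A q"
  shows "transition q c c u = u"
proof -
  have q: "c \<in> A" "q \<in> fst c" using c by (auto simp: charts_at_def)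
  have "(coord_rep c (snd c) has_derivative (\<lambda>u. u)) (at (snd c q))"
    by (rule has_derivative_transform_within_open[OF has_derivative_ident open_chart_range[OF q(1)]])
      (use q in \<open>auto simp: coord_rep_def chart_inv\<close>)
  from frechet_derivative_eqI[OF this] show ?thesis
    by (simp add: transition_def)
qed

text \<open>The tangent vector with coordinates u in the base chart. The value 0 on charts away from
  q is the one prescribed by \<open>tangent_space\<close>.\<close>

definition tvec :: "'m \<Rightarrow> real^2 \<Rightarrow> 'm tvec" where
  "tvec q u c = (if c \<in> charts_at A q then transition q (base_chart q) c u else 0)"

lemma tvec_in: "tvec q u \<in> tangent_space A q"
  unfolding tangent_space_def tvec_def transition_def[symmetric]
  using base_chart by (auto simp: transition_trans)

lemma tvec_base_chart: "tvec q u (base_chart q) = u"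
  using base_chart by (simp add: tvec_def transition_refl)

lemma tangent_space_transition:
  "v \<in> tangent_space A q \<Longrightarrow> c \<in> charts_at A q \<Longrightarrow> v c = transition q (base_chart q) c (v (base_chart q))"
  using base_chart unfolding tangent_space_def transition_def by blast

text \<open>One chart decides, because chart changes have positive Jacobian determinant.\<close>

lemma pos_basis_iff_det:
  assumes "v \<in> tangent_space A q" "w \<in> tangent_space A q"
  shows "pos_basis A q v w \<longleftrightarrow> det (vector [v (base_chart q), w (base_chart q)] :: real^2^2) > 0"
proof -
  have "det (vector [v c, w c] :: real^2^2) > 0"
    if "det (vector [v (base_chart q), w (base_chart q)] :: real^2^2) > 0" "c \<in> charts_at A q" for c
    unfolding tangent_space_transition[OF assms(1) that(2)] tangent_space_transition[OF assms(2) that(2)]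
      det_vector_2_linear[OF linear_transition[OF base_chart that(2)]]
    using transition_det[OF base_chart that(2)] that(1) by simp
  then show ?thesis
    using assms base_chart by (auto simp: pos_basis_def)
qed

text \<open>The locale assumption is one implication. Both signs belong to determinants that differ
  by a constant factor \<open>?K\<close>, and one positive basis shows \<open>?K > 0\<close>; the
  converse follows. It is needed to realise every positive basis of the Gauss plane.\<close>

lemma pos_basis_iff:
  assumes q: "q \<in> U" and v: "v \<in> tangent_space A q" and w: "w \<in> tangent_space A q"
  shows "pos_basis A q v w \<longleftrightarrow> Im (cnj (tdiff A z q v) * tdiff A z q w) > 0"
proof -
  let ?f = "frechet_derivative (coord_rep (base_chart q) z) (at (snd (base_chart q) q))"
  let ?K = "Im (cnj (?f (axis 1 1)) * ?f (axis 2 1))"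
  have eq: "Im (cnj (tdiff A z q v) * tdiff A z q w) =
      ?K * det (vector [v (base_chart q), w (base_chart q)] :: real^2^2)" for v w
    unfolding tdiff_eq by (rule Im_cnj_mult_linear[OF linear_z_chart[OF q]])
  have "pos_basis A q (tvec q (axis 1 1)) (tvec q (axis 2 1))"
    unfolding pos_basis_iff_det[OF tvec_in tvec_in] tvec_base_chart det_vector_2 by (simp add: axis_def)
  from positive[OF q this] have "?K > 0"
    unfolding eq tvec_base_chart det_vector_2 by (simp add: axis_def)
  then show ?thesis
    unfolding pos_basis_iff_det[OF v w] eq by (simp add: zero_less_mult_iff)
qed

text \<open>Differentiating the identity z o \<open>z_inv\<close> = id through the base chart
  produces a right inverse of dz.\<close>

lemma exists_tdiff_z:
  assumes q: "q \<in> U"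
  shows "\<exists>v\<in>tangent_space A q. tdiff A z q v = \<zeta>"
proof -
  let ?c = "base_chart q"
  note c = base_chart_in[of q]
  have op: "open (z ` (U \<inter> fst ?c))" using open_z_image[OF c(1) open_UNIV] by simp
  have zq: "(snd ?c \<circ> z_inv) (z q) = snd ?c q" using z_inv_z[OF q] by simp
  have M: "((snd ?c \<circ> z_inv) has_derivative frechet_derivative (snd ?c \<circ> z_inv) (at (z q))) (at (z q))"
    by (rule smooth_on_has_derivative[OF smooth_chart_z[OF c(1)]]) (use c q in auto)
  have "((\<lambda>p. coord_rep ?c z ((snd ?c \<circ> z_inv) p)) has_derivative
      (\<lambda>u. frechet_derivative (coord_rep ?c z) (at (snd ?c q)) (frechet_derivative (snd ?c \<circ> z_inv) (at (z q)) u)))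
      (at (z q))"
    by (rule has_derivative_compose[OF M]) (use z_chart_has_derivative[OF q] zq in simp)
  then have "((\<lambda>p. p) has_derivative
      (\<lambda>u. frechet_derivative (coord_rep ?c z) (at (snd ?c q)) (frechet_derivative (snd ?c \<circ> z_inv) (at (z q)) u)))
      (at (z q))"
    by (rule has_derivative_transform_within_open[OF _ op])
      (use c q in \<open>auto simp: coord_rep_def chart_inv z_inv_z\<close>)
  then have "frechet_derivative (coord_rep ?c z) (at (snd ?c q)) (frechet_derivative (snd ?c \<circ> z_inv) (at (z q)) \<zeta>) = \<zeta>"
    using has_derivative_unique[OF _ has_derivative_ident] by metis
  then show ?thesis
    by (intro bexI[OF _ tvec_in[of q "frechet_derivative (snd ?c \<circ> z_inv) (at (z q)) \<zeta>"]])
      (simp add: tdiff_eq tvec_base_chart)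
qed

end

section \<open>Symplectic linear algebra\<close>

lemma symp_form_eq: "symp_form x y = x $ 1 * y $ 3 + x $ 2 * y $ 4 - x $ 3 * y $ 1 - x $ 4 * y $ 2"
  by (simp add: symp_form_def J4_def inner_vec_def matrix_vector_mult_def sum_4 algebra_simps)

lemma bounded_bilinear_symp_form: "bounded_bilinear symp_form"
proof (rule bilinear_conv_bounded_bilinear[THEN iffD1])
  show "bilinear symp_form"
    unfolding bilinear_def by (auto intro!: linearI simp: symp_form_eq algebra_simps)
qed

lemma symp_form_skew: "symp_form y x = - symp_form x y"
  by (simp add: symp_form_eq algebra_simps)

lemma symp_form_self [simp]: "symp_form x x = 0"
  by (simp add: symp_form_eq)

lemmas symp_form_simps =
  bounded_bilinear.add_left[OF bounded_bilinear_symp_form]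
  bounded_bilinear.add_right[OF bounded_bilinear_symp_form]
  bounded_bilinear.diff_left[OF bounded_bilinear_symp_form]
  bounded_bilinear.diff_right[OF bounded_bilinear_symp_form]
  bounded_bilinear.minus_left[OF bounded_bilinear_symp_form]
  bounded_bilinear.minus_right[OF bounded_bilinear_symp_form]
  bounded_bilinear.scaleR_left[OF bounded_bilinear_symp_form]
  bounded_bilinear.scaleR_right[OF bounded_bilinear_symp_form]
  bounded_bilinear.zero_left[OF bounded_bilinear_symp_form]
  bounded_bilinear.zero_right[OF bounded_bilinear_symp_form]

lemmas smooth_on_symp_form = smooth_on_bounded_bilinear[OF bounded_bilinear_symp_form]

lemma symp_form_J4_right: "symp_form x (J4 *v y) = - (x \<bullet> y)"
  by (simp add: symp_form_eq J4_def inner_vec_def matrix_vector_mult_def sum_4)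

lemma symp_form_J4_J4: "symp_form (J4 *v x) (J4 *v y) = symp_form x y"
  by (simp add: symp_form_eq J4_def inner_vec_def matrix_vector_mult_def sum_4)

definition symplectic_basis :: "real^4 \<Rightarrow> real^4 \<Rightarrow> real^4 \<Rightarrow> real^4 \<Rightarrow> bool" where
  "symplectic_basis q1 q2 r1 r2 \<longleftrightarrow>
     symp_form q1 q2 = 0 \<and> symp_form r1 r2 = 0 \<and>
     symp_form q1 r1 = 1 \<and> symp_form q2 r2 = 1 \<and> symp_form q1 r2 = 0 \<and> symp_form q2 r1 = 0"

lemma symplectic_basisD:
  assumes "symplectic_basis q1 q2 r1 r2"
  shows "symp_form q1 q2 = 0" "symp_form r1 r2 = 0" "symp_form q1 r1 = 1" "symp_form q2 r2 = 1"
    "symp_form q1 r2 = 0" "symp_form q2 r1 = 0"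
    "symp_form q2 q1 = 0" "symp_form r2 r1 = 0" "symp_form r1 q1 = -1" "symp_form r2 q2 = -1"
    "symp_form r2 q1 = 0" "symp_form r1 q2 = 0"
  using assms symp_form_skew[of q2 q1] symp_form_skew[of r2 r1] symp_form_skew[of r1 q1] 
    symp_form_skew[of r2 q2] symp_form_skew[of r2 q1] symp_form_skew[of r1 q2]
  by (simp_all add: symplectic_basis_def)

lemma transpose_J4_entry: "(transpose X ** J4 ** X) $ i $ j = symp_form (column i X) (column j X)"
  by (simp add: symp_form_eq J4_def matrix_matrix_mult_def sum_4 transpose_def column_def algebra_simps)

lemma Sp4_iff: "X \<in> Sp4 \<longleftrightarrow> symplectic_basis (column 1 X) (column 2 X) (column 3 X) (column 4 X)"
proof
  assume "X \<in> Sp4"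
  then have "symp_form (column i X) (column j X) = J4 $ i $ j" for i j
    using transpose_J4_entry[of X i j] by (simp add: Sp4_def)
  then show "symplectic_basis (column 1 X) (column 2 X) (column 3 X) (column 4 X)"
    by (simp add: symplectic_basis_def J4_def)
next
  assume "symplectic_basis (column 1 X) (column 2 X) (column 3 X) (column 4 X)"
  note b = symplectic_basisD[OF this]
  have *: "transpose X ** J4 ** X = J4"
    unfolding vec_eq_iff forall_4 transpose_J4_entry by (simp add: b J4_def)
  \<comment> \<open>As J4 squares to -1, the relation \<open>*\<close> exhibits
    \<open>(- J4) ** transpose X ** J4\<close> as a left inverse of X.\<close>
  have "(- J4) ** J4 = mat 1"
    by (simp add: vec_eq_iff forall_4 J4_def matrix_matrix_mult_def sum_4 mat_def)
  then have "((- J4) ** transpose X ** J4) ** X = mat 1"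
    using * by (metis matrix_mul_assoc)
  then have "invertible X"
    using invertible_left_inverse by blast
  then show "X \<in> Sp4"
    using * by (simp add: Sp4_def)
qed

definition cols4 :: "real^4 \<Rightarrow> real^4 \<Rightarrow> real^4 \<Rightarrow> real^4 \<Rightarrow> real^4^4" where
  "cols4 x1 x2 x3 x4 = (\<chi> i j. if j = 1 then x1 $ i else if j = 2 then x2 $ i else if j = 3 then x3 $ i else x4 $ i)"

lemma column_cols4 [simp]:
  "column 1 (cols4 x1 x2 x3 x4) = x1" "column 2 (cols4 x1 x2 x3 x4) = x2"
  "column 3 (cols4 x1 x2 x3 x4) = x3" "column 4 (cols4 x1 x2 x3 x4) = x4"
  by (simp_all add: cols4_def column_def vec_eq_iff)

text \<open>Invertibility of a symplectic matrix gives some expansion of y; pairing it with the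
  basis vectors identifies the coefficients.\<close>

lemma symplectic_basis_expand:
  assumes "symplectic_basis q1 q2 r1 r2"
  shows "y = - symp_form r1 y *\<^sub>R q1 - symp_form r2 y *\<^sub>R q2 + symp_form q1 y *\<^sub>R r1 + symp_form q2 y *\<^sub>R r2"
proof -
  define X where "X = cols4 q1 q2 r1 r2"
  have "X \<in> Sp4"
    using assms by (simp add: Sp4_iff X_def)
  then obtain Y where "X ** Y = mat 1"
    by (auto simp: Sp4_def invertible_def)
  then have "X *v (Y *v y) = y"
    by (metis matrix_vector_mul_assoc matrix_vector_mul_lid)
  then obtain t where "X *v t = y" by blast
  then have y: "y = t $ 1 *\<^sub>R q1 + t $ 2 *\<^sub>R q2 + t $ 3 *\<^sub>R r1 + t $ 4 *\<^sub>R r2"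
    by (simp add: matrix_mult_sum sum_4 X_def scalar_mult_eq_scaleR)
  show ?thesis
    unfolding y by (simp add: symp_form_simps symplectic_basisD[OF assms])
qed

lemma symp_form_symplectic_basis:
  assumes "symplectic_basis q1 q2 r1 r2"
  shows "symp_form x y = symp_form q1 x * symp_form r1 y + symp_form q2 x * symp_form r2 y
    - symp_form r1 x * symp_form q1 y - symp_form r2 x * symp_form q2 y"
proof -
  have "symp_form x y = symp_form (- symp_form r1 x *\<^sub>R q1 - symp_form r2 x *\<^sub>R q2 + symp_form q1 x *\<^sub>R r1 + symp_form q2 x *\<^sub>R r2) y"
    using symplectic_basis_expand[OF assms, of x] by simp
  also have "\<dots> = symp_form q1 x * symp_form r1 y + symp_form q2 x * symp_form r2 y
    - symp_form r1 x * symp_form q1 y - symp_form r2 x * symp_form q2 y"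
    by (simp add: symp_form_simps)
  finally show ?thesis .
qed

text \<open>Strict Cauchy-Schwarz: u is (y . y) times the component of x orthogonal to y, and its
  squared length is (y . y) times the Gram determinant.\<close>

lemma gram_det_nonzero:
  fixes x y :: "'a::real_inner"
  assumes "\<And>a b. a *\<^sub>R x + b *\<^sub>R y = 0 \<Longrightarrow> a = 0 \<and> b = 0"
  shows "(x \<bullet> x) * (y \<bullet> y) - (x \<bullet> y) * (x \<bullet> y) \<noteq> 0"
proof
  assume G: "(x \<bullet> x) * (y \<bullet> y) - (x \<bullet> y) * (x \<bullet> y) = 0"
  define u where "u = (y \<bullet> y) *\<^sub>R x + (- (x \<bullet> y)) *\<^sub>R y"
  have "u \<bullet> u = (y \<bullet> y) * ((x \<bullet> x) * (y \<bullet> y) - (x \<bullet> y) * (x \<bullet> y))"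
    by (simp add: u_def inner_simps inner_commute algebra_simps)
  then have "u = 0" using G by simp
  then have "y \<bullet> y = 0" using assms u_def by metis
  then show False using assms[of 0 1] by simp
qed

text \<open>J4 maps a Lagrangian plane onto its orthogonal complement, which is again Lagrangian.
  R1, R2 are the images under -J4 of the Euclidean dual basis of Q1, Q2 inside their plane, because
  \<Omega>(x, J4 y) = -(x . y); d is the Gram determinant in that dual basis.\<close>

lemma smooth_lagrangian_complement:
  fixes Q1 Q2 :: "'a::real_normed_vector \<Rightarrow> real^4"
  assumes D: "open D" and Q: "smooth_on D Q1" "smooth_on D Q2"
    and lagr: "\<And>p. p \<in> D \<Longrightarrow> symp_form (Q1 p) (Q2 p) = 0"
    and indep: "\<And>p a b. p \<in> D \<Longrightarrow> a *\<^sub>R Q1 p + b *\<^sub>R Q2 p = 0 \<Longrightarrow> a = 0 \<and> b = 0"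
  shows "\<exists>R1 R2. smooth_on D R1 \<and> smooth_on D R2 \<and>
    (\<forall>p\<in>D. symplectic_basis (Q1 p) (Q2 p) (R1 p) (R2 p))"
proof -
  define d where "d p = (Q1 p \<bullet> Q1 p) * (Q2 p \<bullet> Q2 p) - (Q1 p \<bullet> Q2 p) * (Q1 p \<bullet> Q2 p)" for p
  define R1 where "R1 p = (- 1 / d p) *\<^sub>R (J4 *v ((Q2 p \<bullet> Q2 p) *\<^sub>R Q1 p - (Q1 p \<bullet> Q2 p) *\<^sub>R Q2 p))" for p
  define R2 where "R2 p = (- 1 / d p) *\<^sub>R (J4 *v ((Q1 p \<bullet> Q1 p) *\<^sub>R Q2 p - (Q1 p \<bullet> Q2 p) *\<^sub>R Q1 p))" for p
  have d: "d p \<noteq> 0" if "p \<in> D" for p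
    unfolding d_def by (rule gram_det_nonzero[OF indep[OF that]])
  have sd: "smooth_on D d"
    unfolding d_def by (intro smooth_on_diff smooth_on_mult smooth_on_inner D Q)
  have "smooth_on D R1" "smooth_on D R2"
    unfolding R1_def R2_def
    by (intro smooth_on_scaleR smooth_on_divide smooth_on_bounded_linear[OF matrix_vector_mul_bounded_linear]
        smooth_on_diff smooth_on_inner smooth_on_const D Q sd d; assumption)+
  moreover have "symplectic_basis (Q1 p) (Q2 p) (R1 p) (R2 p)" if "p \<in> D" for p
  proof -
    have Q: "symp_form (Q1 p) (Q2 p) = 0" "symp_form (Q2 p) (Q1 p) = 0"
      using lagr[OF that] symp_form_skew[of "Q2 p" "Q1 p"] by simp_all
    have RR: "symp_form (R1 p) (R2 p) = 0"
      unfolding R1_def R2_def symp_form_simps(7,8) symp_form_J4_J4 by (simp add: symp_form_simps Q)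
    have QR: "symp_form x (R1 p) = ((Q2 p \<bullet> Q2 p) * (x \<bullet> Q1 p) - (Q1 p \<bullet> Q2 p) * (x \<bullet> Q2 p)) / d p"
      "symp_form x (R2 p) = ((Q1 p \<bullet> Q1 p) * (x \<bullet> Q2 p) - (Q1 p \<bullet> Q2 p) * (x \<bullet> Q1 p)) / d p" for x
      unfolding R1_def R2_def symp_form_simps(8) symp_form_J4_right
          by (simp_all add: inner_diff_right diff_divide_distrib)
    have d': "(Q1 p \<bullet> Q1 p) * (Q2 p \<bullet> Q2 p) - (Q1 p \<bullet> Q2 p) * (Q1 p \<bullet> Q2 p) = d p"
      by (simp add: d_def)
    show ?thesis
      unfolding symplectic_basis_def RR QR[of "Q1 p"] QR[of "Q2 p"] Q using d[OF that] d'
      by (simp add: inner_commute[of "Q2 p" "Q1 p"] mult.commute)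
  qed
  ultimately show ?thesis by blast
qed

section \<open>Adapted symplectic bases over a plane domain\<close>

lemma symp_form_has_derivative:
  assumes "smooth_on D G" "smooth_on D H" "p \<in> D"
  shows "((\<lambda>p. symp_form (G p) (H p)) has_derivative
     (\<lambda>v. symp_form (G p) (frechet_derivative H (at p) v) + symp_form (frechet_derivative G (at p) v) (H p))) (at p)"
  using bounded_bilinear.FDERIV[OF bounded_bilinear_symp_form smooth_on_has_derivative[OF assms(1,3)]
      smooth_on_has_derivative[OF assms(2,3)]] .

text \<open>Product rule and skewness. For two of the first two columns of a frame this is the
  symmetry of the block \<gamma>.\<close>

lemma symp_form_derivative_const:
  assumes "open D" "smooth_on D G" "smooth_on D H" "p \<in> D" "\<And>p. p \<in> D \<Longrightarrow> symp_form (G p) (H p) = k"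
  shows "symp_form (G p) (frechet_derivative H (at p) v) = symp_form (H p) (frechet_derivative G (at p) v)"
proof -
  have "((\<lambda>_. k) has_derivative
     (\<lambda>v. symp_form (G p) (frechet_derivative H (at p) v) + symp_form (frechet_derivative G (at p) v) (H p))) (at p)"
    by (rule has_derivative_transform_within_open[OF symp_form_has_derivative[OF assms(2-4)] assms(1,4,5)])
  from fun_cong[OF has_derivative_unique[OF this has_derivative_const], of v]
  have "symp_form (G p) (frechet_derivative H (at p) v) + symp_form (frechet_derivative G (at p) v) (H p) = 0" .
  then show ?thesis
    using symp_form_skew[of "H p"] by simp
qed

text \<open>The one-form \<Omega>(G, dH) has constant coefficients, so it is closed, and its
  exterior derivative is \<Omega>(dG \<and> dH). For columns this is an entry of the structure
  equation; the proof needs only the symmetry of second derivatives of H.\<close>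

lemma symp_form_derivative_derivative:
  assumes D: "open D" and G: "smooth_on D G" "smooth_on D H" and p: "p \<in> D"
    and k: "\<And>p v. p \<in> D \<Longrightarrow> symp_form (G p) (frechet_derivative H (at p) v) = k v"
  shows "symp_form (frechet_derivative G (at p) v) (frechet_derivative H (at p) w) =
    symp_form (frechet_derivative G (at p) w) (frechet_derivative H (at p) v)"
proof -
  have "symp_form (G p) (frechet_derivative (\<lambda>p. frechet_derivative H (at p) v) (at p) w)
      = symp_form (frechet_derivative H (at p) v) (frechet_derivative G (at p) w)" for v w
    by (rule symp_form_derivative_const[OF D G(1) smooth_on_frechet_derivative[OF G(2)] p k])
  from this[of v w] this[of w v] show ?thesis
    using symmetric_frechet_derivative[OF D G(2) p, of v w]
      symp_form_skew[of "frechet_derivative G (at p) w"] symp_form_skew[of "frechet_derivative G (at p) v"] by simp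
qed

lemma linear_complex_expansion:
  assumes "linear f"
  shows "f \<zeta> = Re \<zeta> *\<^sub>R f 1 + Im \<zeta> *\<^sub>R f \<i>"
proof -
  have "\<zeta> = Re \<zeta> *\<^sub>R 1 + Im \<zeta> *\<^sub>R \<i>"
    by (simp add: complex_eq_iff)
  then have "f \<zeta> = f (Re \<zeta> *\<^sub>R 1 + Im \<zeta> *\<^sub>R \<i>)" by simp
  then show ?thesis by (simp only: linear_add[OF assms] linear_scale[OF assms])
qed

lemma smooth_on_expansion:
  "smooth_on D G \<Longrightarrow> p \<in> D \<Longrightarrow>
    frechet_derivative G (at p) \<zeta> = Re \<zeta> *\<^sub>R frechet_derivative G (at p) 1 + Im \<zeta> *\<^sub>R frechet_derivative G (at p) \<i>"
  by (rule linear_complex_expansion[OF smooth_on_linear_frechet_derivative])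

text \<open>The condition \<open>\<omega> = dz\<close> on the first two columns \<open>q1, q2\<close> of a frame with differentials \<open>d1, d2\<close>.\<close>

definition normal_gamma :: "real^4 \<Rightarrow> real^4 \<Rightarrow> (complex \<Rightarrow> real^4) \<Rightarrow> (complex \<Rightarrow> real^4) \<Rightarrow> bool" where
  "normal_gamma q1 q2 d1 d2 \<longleftrightarrow> (\<forall>\<zeta>.
     symp_form q1 (d1 \<zeta>) = Re \<zeta> \<and> symp_form q2 (d1 \<zeta>) = Im \<zeta> \<and> symp_form q2 (d2 \<zeta>) = - Re \<zeta>)"

text \<open>Here \<open>- symp_form r_i (d_j \<zeta>)\<close> is the entry \<open>\<alpha>\<^sup>i\<^sub>j\<close>. The last two equations say that the
  real linear form \<open>\<eta>\<close> is complex linear.\<close>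

definition normal_alpha :: "real^4 \<Rightarrow> real^4 \<Rightarrow> (complex \<Rightarrow> real^4) \<Rightarrow> (complex \<Rightarrow> real^4) \<Rightarrow> bool" where
  "normal_alpha r1 r2 d1 d2 \<longleftrightarrow>
     (\<forall>\<zeta>. symp_form r1 (d1 \<zeta>) + symp_form r2 (d2 \<zeta>) = 0 \<and> symp_form r2 (d1 \<zeta>) = symp_form r1 (d2 \<zeta>)) \<and>
     symp_form r1 (d1 \<i>) - symp_form r2 (d2 \<i>) = symp_form r2 (d1 1) + symp_form r1 (d2 1) \<and>
     symp_form r2 (d1 \<i>) + symp_form r1 (d2 \<i>) = - (symp_form r1 (d1 1) - symp_form r2 (d2 1))"

lemma exists_normal_complement:
  fixes Q1 Q2 :: "complex \<Rightarrow> real^4"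
  assumes D: "open D" and Q: "smooth_on D Q1" "smooth_on D Q2"
    and lagr: "\<And>p. p \<in> D \<Longrightarrow> symp_form (Q1 p) (Q2 p) = 0"
    and indep: "\<And>p a b. p \<in> D \<Longrightarrow> a *\<^sub>R Q1 p + b *\<^sub>R Q2 p = 0 \<Longrightarrow> a = 0 \<and> b = 0"
    and norm: "\<And>p. p \<in> D \<Longrightarrow>
      normal_gamma (Q1 p) (Q2 p) (frechet_derivative Q1 (at p)) (frechet_derivative Q2 (at p))"
  shows "\<exists>R1 R2. smooth_on D R1 \<and> smooth_on D R2 \<and>
    (\<forall>p\<in>D. symplectic_basis (Q1 p) (Q2 p) (R1 p) (R2 p) \<and>
       normal_alpha (R1 p) (R2 p) (frechet_derivative Q1 (at p)) (frechet_derivative Q2 (at p)))"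
proof -
  obtain R1 R2 where R: "smooth_on D R1" "smooth_on D R2"
    and basis: "\<And>p. p \<in> D \<Longrightarrow> symplectic_basis (Q1 p) (Q2 p) (R1 p) (R2 p)"
    using smooth_lagrangian_complement[of D Q1 Q2] D Q lagr indep by metis
  define d1 where "d1 \<zeta> p = frechet_derivative Q1 (at p) \<zeta>" for \<zeta> p
  define d2 where "d2 \<zeta> p = frechet_derivative Q2 (at p) \<zeta>" for \<zeta> p
  have sd: "smooth_on D (d1 \<zeta>)" "smooth_on D (d2 \<zeta>)" for \<zeta>
    unfolding d1_def d2_def by (rule smooth_on_frechet_derivative[OF Q(1)], rule smooth_on_frechet_derivative[OF Q(2)])
  have g: "symp_form (Q1 p) (d1 \<zeta> p) = Re \<zeta>" "symp_form (Q2 p) (d1 \<zeta> p) = Im \<zeta>"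
    "symp_form (Q2 p) (d2 \<zeta> p) = - Re \<zeta>" if "p \<in> D" for p \<zeta>
    using norm[OF that] by (auto simp: normal_gamma_def d1_def d2_def)
  \<comment> \<open>This entry is absent from \<open>normal_gamma\<close>; it comes from the
    symmetry of \<gamma>.\<close>
  have g12: "symp_form (Q1 p) (d2 \<zeta> p) = Im \<zeta>" if "p \<in> D" for p \<zeta>
    using symp_form_derivative_const[OF D Q that lagr] g(2)[OF that] by (simp add: d1_def d2_def)
  \<comment> \<open>The matrix \<open>s\<close> has rows (s0 + s1, s2) and (s2, s0 - s1). Its
    entries s1 and s2 cancel the trace of \<alpha> along 1 and \<open>\<i>\<close>. Adding s0 times
    the identity changes \<eta> by -s0 times the conjugate of \<omega>, and s0 is exactly the
    coefficient \<open>l\<close> of the frame with last columns R1, R2.\<close>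
  define s0 where "s0 p = - (symp_form (R1 p) (d1 1 p) - symp_form (R2 p) (d2 1 p)
    + symp_form (R2 p) (d1 \<i> p) + symp_form (R1 p) (d2 \<i> p)) / 4" for p
  define s1 where "s1 p = - (symp_form (R1 p) (d1 1 p) + symp_form (R2 p) (d2 1 p)) / 2" for p
  define s2 where "s2 p = - (symp_form (R1 p) (d1 \<i> p) + symp_form (R2 p) (d2 \<i> p)) / 2" for p
  define T1 where "T1 p = R1 p + (s0 p + s1 p) *\<^sub>R Q1 p + s2 p *\<^sub>R Q2 p" for p
  define T2 where "T2 p = R2 p + s2 p *\<^sub>R Q1 p + (s0 p - s1 p) *\<^sub>R Q2 p" for p
  have ss: "smooth_on D s0" "smooth_on D s1" "smooth_on D s2"
    unfolding s0_def s1_def s2_def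
    by (auto intro!: smooth_on_divide smooth_on_minus smooth_on_add smooth_on_diff smooth_on_symp_form D R sd)
  have "smooth_on D T1" "smooth_on D T2"
    unfolding T1_def T2_def by (auto intro!: smooth_on_add smooth_on_diff smooth_on_scaleR D R ss Q)
  moreover have "symplectic_basis (Q1 p) (Q2 p) (T1 p) (T2 p)" if "p \<in> D" for p
    using symplectic_basisD[OF basis[OF that]]
    by (simp add: symplectic_basis_def T1_def T2_def symp_form_simps)
  moreover have "normal_alpha (T1 p) (T2 p) (frechet_derivative Q1 (at p)) (frechet_derivative Q2 (at p))"
    if p: "p \<in> D" for p
  proof -
    note Om = symp_form_symplectic_basis[OF basis[OF p]]
    \<comment> \<open>The three independent entries of \<gamma> are Re dz, -Re dz and Im dz, hence
      closed. Expanded in the symplectic basis, closedness gives the relations \<open>c11\<close>,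
      \<open>c22\<close>, \<open>c12\<close> between coefficients of \<alpha>.\<close>
    have "symp_form (d1 1 p) (d1 \<i> p) = symp_form (d1 \<i> p) (d1 1 p)"
      unfolding d1_def by (rule symp_form_derivative_derivative[OF D Q(1) Q(1) p g(1)[unfolded d1_def]])
    then have c11: "symp_form (R1 p) (d1 \<i> p) = symp_form (R2 p) (d1 1 p)"
      by (simp add: Om[of "d1 _ p" "d1 _ p"] g[OF p])
    have "symp_form (d2 1 p) (d2 \<i> p) = symp_form (d2 \<i> p) (d2 1 p)"
      unfolding d2_def by (rule symp_form_derivative_derivative[OF D Q(2) Q(2) p g(3)[unfolded d2_def]])
    then have c22: "symp_form (R2 p) (d2 \<i> p) = - symp_form (R1 p) (d2 1 p)"
      by (simp add: Om[of "d2 _ p" "d2 _ p"] g[OF p] g12[OF p])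
    have "symp_form (d1 1 p) (d2 \<i> p) = symp_form (d1 \<i> p) (d2 1 p)"
      unfolding d1_def d2_def by (rule symp_form_derivative_derivative[OF D Q p g12[unfolded d2_def]])
    then have c12: "symp_form (R1 p) (d2 \<i> p) - symp_form (R1 p) (d1 1 p) =
        symp_form (R2 p) (d1 \<i> p) + symp_form (R2 p) (d2 1 p)"
      by (simp add: Om[of "d1 _ p" "d2 _ p"] g[OF p] g12[OF p])
    have T: "symp_form (T1 p) (d1 \<zeta> p) = symp_form (R1 p) (d1 \<zeta> p) + (s0 p + s1 p) * Re \<zeta> + s2 p * Im \<zeta>"
       "symp_form (T2 p) (d1 \<zeta> p) = symp_form (R2 p) (d1 \<zeta> p) + s2 p * Re \<zeta> + (s0 p - s1 p) * Im \<zeta>"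
       "symp_form (T1 p) (d2 \<zeta> p) = symp_form (R1 p) (d2 \<zeta> p) + (s0 p + s1 p) * Im \<zeta> - s2 p * Re \<zeta>"
       "symp_form (T2 p) (d2 \<zeta> p) = symp_form (R2 p) (d2 \<zeta> p) + s2 p * Im \<zeta> - (s0 p - s1 p) * Re \<zeta>" for \<zeta>
      unfolding T1_def T2_def by (simp_all add: symp_form_simps g[OF p] g12[OF p])
    have e: "d1 \<zeta> p = Re \<zeta> *\<^sub>R d1 1 p + Im \<zeta> *\<^sub>R d1 \<i> p" "d2 \<zeta> p = Re \<zeta> *\<^sub>R d2 1 p + Im \<zeta> *\<^sub>R d2 \<i> p" for \<zeta>
      unfolding d1_def d2_def by (rule smooth_on_expansion[OF _ p], rule Q)+
    \<comment> \<open>s0 drops out of all four equations. By \<open>c11\<close>, \<open>c22\<close>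
      and \<open>c12\<close> the choice that kills the trace kills the skew part as well.\<close>
    have one: "symp_form (T1 p) (d1 1 p) + symp_form (T2 p) (d2 1 p) = 0"
      "symp_form (T2 p) (d1 1 p) = symp_form (T1 p) (d2 1 p)"
      "symp_form (T1 p) (d1 \<i> p) + symp_form (T2 p) (d2 \<i> p) = 0"
      "symp_form (T2 p) (d1 \<i> p) = symp_form (T1 p) (d2 \<i> p)"
      unfolding T s1_def s2_def using c11 c22 c12 by (simp_all add: field_simps)
    have lin: "symp_form (T1 p) (d1 \<zeta> p) + symp_form (T2 p) (d2 \<zeta> p) =
       Re \<zeta> * (symp_form (T1 p) (d1 1 p) + symp_form (T2 p) (d2 1 p)) +
       Im \<zeta> * (symp_form (T1 p) (d1 \<i> p) + symp_form (T2 p) (d2 \<i> p))"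
      "symp_form (T2 p) (d1 \<zeta> p) = Re \<zeta> * symp_form (T2 p) (d1 1 p) + Im \<zeta> * symp_form (T2 p) (d1 \<i> p)"
      "symp_form (T1 p) (d2 \<zeta> p) = Re \<zeta> * symp_form (T1 p) (d2 1 p) + Im \<zeta> * symp_form (T1 p) (d2 \<i> p)" for \<zeta>
      unfolding e[of \<zeta>] by (simp_all add: symp_form_simps algebra_simps)
    have "symp_form (T1 p) (d1 \<zeta> p) + symp_form (T2 p) (d2 \<zeta> p) = 0 \<and>
        symp_form (T2 p) (d1 \<zeta> p) = symp_form (T1 p) (d2 \<zeta> p)" for \<zeta>
      using lin[of \<zeta>] one by simp
    \<comment> \<open>In the first equation all entries of \<open>s\<close> cancel and it holds by
      \<open>c11\<close> and \<open>c22\<close>; in other words, \<open>l\<close> is real. The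
      second equation determines s0.\<close>
    moreover have "symp_form (T1 p) (d1 \<i> p) - symp_form (T2 p) (d2 \<i> p) =
        symp_form (T2 p) (d1 1 p) + symp_form (T1 p) (d2 1 p)"
      "symp_form (T2 p) (d1 \<i> p) + symp_form (T1 p) (d2 \<i> p) =
        - (symp_form (T1 p) (d1 1 p) - symp_form (T2 p) (d2 1 p))"
      unfolding T s0_def using c11 c22 c12 by (simp_all add: field_simps)
    ultimately show ?thesis
      unfolding normal_alpha_def d1_def[symmetric] d2_def[symmetric] by blast
  qed
  ultimately show ?thesis by blast
qed

text \<open>For the binary cubic with polarised coefficients a, b, c, d the quadratic form is a
  negative multiple of the Hessian determinant. Comparing coefficients gives b^2 - ac = c^2 - bd = r
  and bc = ad. Then r (a + c) and r (b + d) are multiples of bc - ad, so the cubic is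
  harmonic.\<close>

lemma conformal_cubic:
  fixes a b c d :: real
  assumes "r > 0" and
    conf: "\<And>\<zeta>. - (Re \<zeta> * c + Im \<zeta> * d) * (Re \<zeta> * a + Im \<zeta> * b) + (Re \<zeta> * b + Im \<zeta> * c)\<^sup>2 = r * (cmod \<zeta>)\<^sup>2"
  shows "c = - a" "d = - b" "a\<^sup>2 + b\<^sup>2 \<noteq> 0"
proof -
  have 1: "b\<^sup>2 - a * c = r" using conf[of 1] by (simp add: algebra_simps)
  have 2: "c\<^sup>2 - b * d = r" using conf[of \<i>] by (simp add: algebra_simps)
  have "- (c + d) * (a + b) + (b + c)\<^sup>2 = r * 2"
    using conf[of "Complex 1 1"] by (simp add: cmod_power2)
  then have 3: "b * c = a * d" using 1 2 by (simp add: algebra_simps power2_eq_square)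
  have "r * (c + a) = (b\<^sup>2 - a * c) * c + (c\<^sup>2 - b * d) * a"
    using 1 2 by (simp add: distrib_left)
  also have "\<dots> = b * (b * c - a * d)"
    by (simp add: algebra_simps power2_eq_square)
  finally have "r * (c + a) = 0" using 3 by simp
  then show c: "c = - a" using \<open>r > 0\<close> by simp
  have "r * (d + b) = (b\<^sup>2 - a * c) * d + (c\<^sup>2 - b * d) * b"
    using 1 2 by (simp add: distrib_left)
  also have "\<dots> = c * (b * c - a * d)"
    by (simp add: algebra_simps power2_eq_square)
  finally have "r * (d + b) = 0" using 3 by simp
  then show "d = - b" using \<open>r > 0\<close> by simp
  show "a\<^sup>2 + b\<^sup>2 \<noteq> 0" using 1 c \<open>r > 0\<close> by (auto simp: power2_eq_square)
qed

lemma smooth_on_of_real: "open D \<Longrightarrow> smooth_on D f \<Longrightarrow> smooth_on D (\<lambda>p. complex_of_real (f p))"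
  by (rule smooth_on_bounded_linear[OF bounded_linear_of_real])

text \<open>With w = u + \<open>\<i>\<close> v, the two columns are the images under dF of
  \<open>\<i>\<close> cnj w and cnj w. Derivatives of u and v pair to zero with the Lagrangian
  plane, so \<open>normal_gamma\<close> concerns only the cubic form Re (\<kappa>
  \<open>\<zeta>\<close>^3) and amounts to \<kappa> (cnj w)^2 = -1.\<close>

lemma exists_normal_tangent_basis:
  fixes F :: "complex \<Rightarrow> real^4"
  defines "Fx \<equiv> \<lambda>p. frechet_derivative F (at p) 1" and "Fy \<equiv> \<lambda>p. frechet_derivative F (at p) \<i>"
  assumes D: "open D" "contractible D" and F: "smooth_on D F"
    and lagr: "\<And>p. p \<in> D \<Longrightarrow> symp_form (Fx p) (Fy p) = 0"
    and conf: "\<And>p. p \<in> D \<Longrightarrow> \<exists>r>0. \<forall>\<zeta>.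
      - symp_form (Fy p) (frechet_derivative Fy (at p) \<zeta>) * symp_form (Fx p) (frechet_derivative Fx (at p) \<zeta>)
      + (symp_form (Fx p) (frechet_derivative Fy (at p) \<zeta>))\<^sup>2 = r * (cmod \<zeta>)\<^sup>2"
  shows "\<exists>u v. smooth_on D u \<and> smooth_on D v \<and> (\<forall>p\<in>D. u p * u p + v p * v p \<noteq> 0 \<and>
     normal_gamma (u p *\<^sub>R Fy p + v p *\<^sub>R Fx p) (- v p *\<^sub>R Fy p + u p *\<^sub>R Fx p)
       (frechet_derivative (\<lambda>p. u p *\<^sub>R Fy p + v p *\<^sub>R Fx p) (at p))
       (frechet_derivative (\<lambda>p. - v p *\<^sub>R Fy p + u p *\<^sub>R Fx p) (at p)))"
proof -
  have sF: "smooth_on D Fx" "smooth_on D Fy"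
    unfolding Fx_def Fy_def by (rule smooth_on_frechet_derivative[OF F])+
  define dFx where "dFx \<zeta> p = frechet_derivative Fx (at p) \<zeta>" for \<zeta> p
  define dFy where "dFy \<zeta> p = frechet_derivative Fy (at p) \<zeta>" for \<zeta> p
  have sdFx: "smooth_on D (dFx \<zeta>)" for \<zeta>
    unfolding dFx_def by (rule smooth_on_frechet_derivative[OF sF(1)])
  define a where "a p = symp_form (Fx p) (dFx 1 p)" for p
  define b where "b p = symp_form (Fx p) (dFx \<i> p)" for p
  have sab: "smooth_on D a" "smooth_on D b"
    unfolding a_def b_def by (intro smooth_on_symp_form D sF sdFx)+
  have e: "dFx \<zeta> p = Re \<zeta> *\<^sub>R dFx 1 p + Im \<zeta> *\<^sub>R dFx \<i> p" "dFy \<zeta> p = Re \<zeta> *\<^sub>R dFy 1 p + Im \<zeta> *\<^sub>R dFy \<i> p"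
    if "p \<in> D" for \<zeta> p
    unfolding dFx_def dFy_def by (rule smooth_on_expansion[OF _ that], rule sF)+
  \<comment> \<open>Total symmetry of the cubic form: equality of mixed partial derivatives
    exchanges the last two slots, differentiating \<Omega>(Fx, Fy) = 0 exchanges the first
    two.\<close>
  have mixed: "dFy 1 p = dFx \<i> p" if "p \<in> D" for p
    unfolding dFx_def dFy_def Fx_def Fy_def by (rule symmetric_frechet_derivative[OF D(1) F that])
  have swap: "symp_form (Fx p) (dFy \<zeta> p) = symp_form (Fy p) (dFx \<zeta> p)" if "p \<in> D" for \<zeta> p
    unfolding dFx_def dFy_def by (rule symp_form_derivative_const[OF D(1) sF that lagr])
  have cubic: "symp_form (Fx p) (dFx \<zeta> p) = Re \<zeta> * a p + Im \<zeta> * b p"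
      "symp_form (Fx p) (dFy \<zeta> p) = Re \<zeta> * b p - Im \<zeta> * a p"
      "symp_form (Fy p) (dFx \<zeta> p) = Re \<zeta> * b p - Im \<zeta> * a p"
      "symp_form (Fy p) (dFy \<zeta> p) = - Re \<zeta> * a p - Im \<zeta> * b p"
      and nz: "(a p)\<^sup>2 + (b p)\<^sup>2 \<noteq> 0" if p: "p \<in> D" for p \<zeta>
  proof -
    define c where "c = symp_form (Fy p) (dFx \<i> p)"
    define d where "d = symp_form (Fy p) (dFy \<i> p)"
    have xx: "symp_form (Fx p) (dFx \<zeta> p) = Re \<zeta> * a p + Im \<zeta> * b p" for \<zeta>
      by (subst e[OF p]) (simp add: symp_form_simps a_def b_def)
    have xy: "symp_form (Fx p) (dFy \<zeta> p) = Re \<zeta> * b p + Im \<zeta> * c" for \<zeta>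
      by (subst e[OF p]) (simp add: symp_form_simps b_def c_def mixed[OF p] swap[OF p])
    have yy: "symp_form (Fy p) (dFy \<zeta> p) = Re \<zeta> * c + Im \<zeta> * d" for \<zeta>
      by (subst e[OF p]) (simp add: symp_form_simps d_def c_def mixed[OF p])
    obtain r where "r > 0" "\<And>\<zeta>. - symp_form (Fy p) (dFy \<zeta> p) * symp_form (Fx p) (dFx \<zeta> p)
      + (symp_form (Fx p) (dFy \<zeta> p))\<^sup>2 = r * (cmod \<zeta>)\<^sup>2"
      using conf[OF p] unfolding dFx_def dFy_def by blast
    from conformal_cubic[OF this[unfolded xx xy yy]]
    have cd: "c = - a p" "d = - b p" and "(a p)\<^sup>2 + (b p)\<^sup>2 \<noteq> 0" .
    then show "(a p)\<^sup>2 + (b p)\<^sup>2 \<noteq> 0" by simp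
    show "symp_form (Fx p) (dFx \<zeta> p) = Re \<zeta> * a p + Im \<zeta> * b p"
      "symp_form (Fx p) (dFy \<zeta> p) = Re \<zeta> * b p - Im \<zeta> * a p"
      "symp_form (Fy p) (dFx \<zeta> p) = Re \<zeta> * b p - Im \<zeta> * a p"
      "symp_form (Fy p) (dFy \<zeta> p) = - Re \<zeta> * a p - Im \<zeta> * b p"
      using xx xy yy swap[OF p, symmetric] by (simp_all add: cd)
  qed
  \<comment> \<open>Here \<kappa> = a - \<open>\<i>\<close> b and k is minus its conjugate; the sign
    is the square of the factor \<open>\<i>\<close> in the first column. So w^2 = 1 / k.\<close>
  define k where "k p = complex_of_real (- a p) + \<i> * complex_of_real (- b p)" for p
  have k: "k p \<noteq> 0" if "p \<in> D" for p
    using nz[OF that] by (auto simp: k_def complex_eq_iff)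
  have sk: "smooth_on D (\<lambda>p. inverse (k p))"
    unfolding k_def using k
    by (intro smooth_on_inverse smooth_on_add smooth_on_mult smooth_on_of_real smooth_on_minus smooth_on_const D sab)
       (simp add: k_def)
  obtain w where cw: "continuous_on D w" and w: "\<And>p. p \<in> D \<Longrightarrow> inverse (k p) = (w p)\<^sup>2"
    using continuous_sqrt_on_contractible[OF smooth_on_continuous_on[OF sk] D(2)] k by auto
  have w0: "w p \<noteq> 0" if "p \<in> D" for p
    using w[OF that] k[OF that] by auto
  have sw: "smooth_on D w"
    by (rule smooth_on_continuous_sqrt[OF D(1) cw w[symmetric] w0 sk])
  define u where "u p = Re (w p)" for p
  define v where "v p = Im (w p)" for p
  have su: "smooth_on D u" "smooth_on D v"
    unfolding u_def v_def by (rule smooth_on_bounded_linear[OF _ D(1) sw], rule bounded_linear_Re bounded_linear_Im)+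
  have uv: "- a p * (u p * u p - v p * v p) + 2 * b p * (u p * v p) = 1"
    "- b p * (u p * u p - v p * v p) - 2 * a p * (u p * v p) = 0" if "p \<in> D" for p
  proof -
    have "(w p)\<^sup>2 * k p = 1"
      using w[OF that] k[OF that] by (metis left_inverse)
    then have "Re ((w p)\<^sup>2 * k p) = 1" "Im ((w p)\<^sup>2 * k p) = 0" by simp_all
    then show "- a p * (u p * u p - v p * v p) + 2 * b p * (u p * v p) = 1"
      "- b p * (u p * u p - v p * v p) - 2 * a p * (u p * v p) = 0"
      by (simp_all add: k_def u_def v_def power2_eq_square algebra_simps)
  qed
  have yx: "symp_form (Fy p) (Fx p) = 0" if "p \<in> D" for p
    using lagr[OF that] symp_form_skew[of "Fy p" "Fx p"] by simp
  have d: "((\<lambda>p. f p *\<^sub>R Fy p + g p *\<^sub>R Fx p) has_derivative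
      (\<lambda>\<zeta>. f p *\<^sub>R dFy \<zeta> p + frechet_derivative f (at p) \<zeta> *\<^sub>R Fy p + (g p *\<^sub>R dFx \<zeta> p + frechet_derivative g (at p) \<zeta> *\<^sub>R Fx p))) (at p)"
    if "smooth_on D f" "smooth_on D g" "p \<in> D" for f g p
    unfolding dFx_def dFy_def
    by (intro has_derivative_add bounded_bilinear.FDERIV[OF bounded_bilinear_scaleR] smooth_on_has_derivative[OF _ that(3)] that sF)
  have "normal_gamma (u p *\<^sub>R Fy p + v p *\<^sub>R Fx p) (- v p *\<^sub>R Fy p + u p *\<^sub>R Fx p)
       (frechet_derivative (\<lambda>p. u p *\<^sub>R Fy p + v p *\<^sub>R Fx p) (at p))
       (frechet_derivative (\<lambda>p. - v p *\<^sub>R Fy p + u p *\<^sub>R Fx p) (at p))" if p: "p \<in> D" for p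
  proof -
    \<comment> \<open>The equations \<open>uv\<close> in the combinations to which the three
      pairings expand.\<close>
    have "Re \<zeta> * (- a p * (u p * u p - v p * v p) + 2 * b p * (u p * v p)) +
       Im \<zeta> * (- b p * (u p * u p - v p * v p) - 2 * a p * (u p * v p)) = Re \<zeta>"
      "Im \<zeta> * (- a p * (u p * u p - v p * v p) + 2 * b p * (u p * v p)) -
       Re \<zeta> * (- b p * (u p * u p - v p * v p) - 2 * a p * (u p * v p)) = Im \<zeta>" for \<zeta>
      unfolding uv[OF p] by simp_all
    then show ?thesis
      unfolding normal_gamma_def frechet_derivative_eqI[OF d[OF su p]]
        frechet_derivative_eqI[OF d[OF smooth_on_minus[OF D(1) su(2)] su(1) p]]
      by (simp add: symp_form_simps cubic[OF p] lagr[OF p] yx[OF p] algebra_simps)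
  qed
  moreover have "u p * u p + v p * v p \<noteq> 0" if "p \<in> D" for p
    using w0[OF that] by (auto simp: u_def v_def complex_eq_iff sum_squares_eq_zero_iff)
  ultimately show ?thesis
    using su by blast
qed

section \<open>Uniqueness over a plane domain\<close>

text \<open>The coefficients a, b, c, d are given pointwise without regularity and are never
  differentiated: \<Omega>(Q_i, Q1') vanishes on D, and differentiating this moves the derivative
  from Q1' to Q_i. The result is (a + \<open>\<i>\<close> b)^2 = 1, the ambiguity of the square
  root.\<close>

lemma normal_gamma_unique:
  assumes D: "open D" and Q: "smooth_on D Q1" "smooth_on D Q2" and Q': "smooth_on D Q1'" "smooth_on D Q2'"
    and lagr: "\<And>p. p \<in> D \<Longrightarrow> symp_form (Q1 p) (Q2 p) = 0"
    and norm: "\<And>p. p \<in> D \<Longrightarrow>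
      normal_gamma (Q1 p) (Q2 p) (frechet_derivative Q1 (at p)) (frechet_derivative Q2 (at p))"
    and norm': "\<And>p. p \<in> D \<Longrightarrow>
      normal_gamma (Q1' p) (Q2' p) (frechet_derivative Q1' (at p)) (frechet_derivative Q2' (at p))"
    and same: "\<And>p. p \<in> D \<Longrightarrow> \<exists>a b c d. Q1' p = a *\<^sub>R Q1 p + b *\<^sub>R Q2 p \<and> Q2' p = c *\<^sub>R Q1 p + d *\<^sub>R Q2 p"
    and p: "p \<in> D"
  shows "Q1' p = Q1 p \<and> Q2' p = Q2 p \<or> Q1' p = - Q1 p \<and> Q2' p = - Q2 p"
proof -
  obtain a b c d where q: "Q1' p = a *\<^sub>R Q1 p + b *\<^sub>R Q2 p" "Q2' p = c *\<^sub>R Q1 p + d *\<^sub>R Q2 p"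
    using same[OF p] by blast
  have l: "symp_form (Q1 p) (Q1' p) = 0 \<and> symp_form (Q2 p) (Q1' p) = 0" if "p \<in> D" for p
    using same[OF that] lagr[OF that] symp_form_skew[of "Q2 p" "Q1 p"] by (auto simp: symp_form_simps)
  define d1 where "d1 = frechet_derivative Q1 (at p)"
  define d2 where "d2 = frechet_derivative Q2 (at p)"
  define d1' where "d1' = frechet_derivative Q1' (at p)"
  have g: "symp_form (Q1 p) (d1 \<zeta>) = Re \<zeta>" "symp_form (Q2 p) (d1 \<zeta>) = Im \<zeta>"
      "symp_form (Q2 p) (d2 \<zeta>) = - Re \<zeta>" for \<zeta>
    using norm[OF p] by (auto simp: normal_gamma_def d1_def d2_def)
  have g12: "symp_form (Q1 p) (d2 \<zeta>) = Im \<zeta>" for \<zeta>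
    using symp_form_derivative_const[OF D Q p lagr, of \<zeta>] g(2) by (simp add: d1_def d2_def)
  have g': "symp_form (Q1' p) (d1' \<zeta>) = Re \<zeta>" "symp_form (Q2' p) (d1' \<zeta>) = Im \<zeta>" for \<zeta>
    using norm'[OF p] by (auto simp: normal_gamma_def d1'_def)
  have x1: "symp_form (Q1 p) (d1' \<zeta>) = a * Re \<zeta> + b * Im \<zeta>" for \<zeta>
    using symp_form_derivative_const[OF D Q(1) Q'(1) p, of 0 \<zeta>] l
    by (simp add: q symp_form_simps g g12 flip: d1_def d1'_def)
  have x2: "symp_form (Q2 p) (d1' \<zeta>) = a * Im \<zeta> - b * Re \<zeta>" for \<zeta>
    using symp_form_derivative_const[OF D Q(2) Q'(1) p, of 0 \<zeta>] l
    by (simp add: q symp_form_simps g g12 flip: d2_def d1'_def)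
  have e1: "a * (a * Re \<zeta> + b * Im \<zeta>) + b * (a * Im \<zeta> - b * Re \<zeta>) = Re \<zeta>" 
    and e2: "c * (a * Re \<zeta> + b * Im \<zeta>) + d * (a * Im \<zeta> - b * Re \<zeta>) = Im \<zeta>" for \<zeta>
    using g'[of \<zeta>] unfolding q by (simp_all add: symp_form_simps x1 x2)
  have "a * a - b * b = 1" "a * b = 0" using e1[of 1] e1[of \<i>] by auto
  have "a \<noteq> 0"
  proof
    assume "a = 0"
    then have "b * b = - 1" using \<open>a * a - b * b = 1\<close> by simp
    then show False using zero_le_square[of b] by linarith
  qed
  then have b: "b = 0"
    using \<open>a * b = 0\<close> by simp
  then have a: "a = 1 \<or> a = -1"
    using \<open>a * a - b * b = 1\<close> by (simp add: square_eq_1_iff)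
  have "c = 0" "d * a = 1" using e2[of 1] e2[of \<i>] a b by auto
  then show ?thesis
    using a b unfolding q by auto
qed

lemma normal_frame_unique:
  assumes D: "open D" "connected D"
    and Q: "smooth_on D Q1" "smooth_on D Q2" and Q': "smooth_on D Q1'" "smooth_on D Q2'"
    and basis: "\<And>p. p \<in> D \<Longrightarrow> symplectic_basis (Q1 p) (Q2 p) (R1 p) (R2 p)"
    and basis': "\<And>p. p \<in> D \<Longrightarrow> symplectic_basis (Q1' p) (Q2' p) (R1' p) (R2' p)"
    and norm: "\<And>p. p \<in> D \<Longrightarrow>
      normal_gamma (Q1 p) (Q2 p) (frechet_derivative Q1 (at p)) (frechet_derivative Q2 (at p))"
    and norm': "\<And>p. p \<in> D \<Longrightarrow>
      normal_gamma (Q1' p) (Q2' p) (frechet_derivative Q1' (at p)) (frechet_derivative Q2' (at p))"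
    and alpha: "\<And>p. p \<in> D \<Longrightarrow>
      normal_alpha (R1 p) (R2 p) (frechet_derivative Q1 (at p)) (frechet_derivative Q2 (at p))"
    and alpha': "\<And>p. p \<in> D \<Longrightarrow>
      normal_alpha (R1' p) (R2' p) (frechet_derivative Q1' (at p)) (frechet_derivative Q2' (at p))"
    and same: "\<And>p. p \<in> D \<Longrightarrow> \<exists>a b c d. Q1' p = a *\<^sub>R Q1 p + b *\<^sub>R Q2 p \<and> Q2' p = c *\<^sub>R Q1 p + d *\<^sub>R Q2 p"
  shows "\<exists>e\<in>{1, -1}. \<forall>p\<in>D. Q1' p = e *\<^sub>R Q1 p \<and> Q2' p = e *\<^sub>R Q2 p \<and> R1' p = e *\<^sub>R R1 p \<and> R2' p = e *\<^sub>R R2 p"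
proof -
  have lagr: "symp_form (Q1 p) (Q2 p) = 0" if "p \<in> D" for p
    using symplectic_basisD(1)[OF basis[OF that]] .
  have pm: "Q1' p = Q1 p \<and> Q2' p = Q2 p \<or> Q1' p = - Q1 p \<and> Q2' p = - Q2 p" if "p \<in> D" for p
    by (rule normal_gamma_unique[OF D(1) Q Q' lagr norm norm' same that])
  have nz: "Q1 p \<noteq> 0" if "p \<in> D" for p
    using symplectic_basisD(3)[OF basis[OF that]] by (auto simp: symp_form_simps)
  \<comment> \<open>A continuous formula for the pointwise sign; with values in {1, -1} it is
    constant on the connected set D.\<close>
  define E where "E p = (Q1' p \<bullet> Q1 p) / (Q1 p \<bullet> Q1 p)" for p
  have E: "E p = 1 \<and> Q1' p = Q1 p \<and> Q2' p = Q2 p \<or> E p = -1 \<and> Q1' p = - Q1 p \<and> Q2' p = - Q2 p" if "p \<in> D"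
      for p
    using pm[OF that] nz[OF that] by (auto simp: E_def)
  have "continuous_on D E"
    unfolding E_def using nz by (intro continuous_intros smooth_on_continuous_on Q Q') auto
  moreover have "E ` D \<subseteq> {1, -1}" using E by auto
  then have "finite (E ` D)" using finite_subset by blast
  ultimately have "E constant_on D"
    using continuous_finite_range_constant[OF D(2)] by blast
  then obtain e where e: "e \<in> {1, -1}" "\<And>p. p \<in> D \<Longrightarrow> E p = e"
    using E unfolding constant_on_def by (metis insertCI)
  have eQ: "Q1' p = e *\<^sub>R Q1 p" "Q2' p = e *\<^sub>R Q2 p" if "p \<in> D" for p
    using E[OF that] e that by auto
  have ee: "e * e = 1" using e(1) by auto
  have "R1' p = e *\<^sub>R R1 p \<and> R2' p = e *\<^sub>R R2 p" if p: "p \<in> D" for p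
  proof -
    note B = basis[OF p] and b = symplectic_basisD[OF basis[OF p]] and b' = symplectic_basisD[OF basis'[OF p]]
    define d1 where "d1 = frechet_derivative Q1 (at p)"
    define d2 where "d2 = frechet_derivative Q2 (at p)"
    have der: "frechet_derivative H' (at p) = (\<lambda>\<zeta>. e *\<^sub>R frechet_derivative H (at p) \<zeta>)"
      if "smooth_on D H" "\<And>p. p \<in> D \<Longrightarrow> H' p = e *\<^sub>R H p" for H H' :: "complex \<Rightarrow> real^4"
    proof (rule frechet_derivative_eqI)
      have "((\<lambda>p. e *\<^sub>R H p) has_derivative (\<lambda>\<zeta>. e *\<^sub>R frechet_derivative H (at p) \<zeta>)) (at p)"
        by (intro has_derivative_scaleR_right smooth_on_has_derivative[OF that(1) p])
      then show "(H' has_derivative (\<lambda>\<zeta>. e *\<^sub>R frechet_derivative H (at p) \<zeta>)) (at p)"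
        by (rule has_derivative_transform_within_open[OF _ D(1) p]) (simp add: that(2))
    qed
    have d': "frechet_derivative Q1' (at p) = (\<lambda>\<zeta>. e *\<^sub>R d1 \<zeta>)"
        "frechet_derivative Q2' (at p) = (\<lambda>\<zeta>. e *\<^sub>R d2 \<zeta>)"
      unfolding d1_def d2_def by (simp_all only: der[OF Q(1) eQ(1)] der[OF Q(2) eQ(2)])
    have g: "symp_form (Q1 p) (d1 \<zeta>) = Re \<zeta>" "symp_form (Q2 p) (d1 \<zeta>) = Im \<zeta>"
        "symp_form (Q2 p) (d2 \<zeta>) = - Re \<zeta>"
      "symp_form (Q1 p) (d2 \<zeta>) = Im \<zeta>" for \<zeta>
      using norm[OF p] symp_form_derivative_const[OF D(1) Q p lagr, of \<zeta>]
      by (auto simp: normal_gamma_def d1_def d2_def)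
    \<comment> \<open>The m's form the matrix of the change of the last two columns; it is symmetric
      because R1', R2' are again orthogonal for \<Omega> (\<open>sym\<close>).\<close>
    define m11 where "m11 = - symp_form (R1 p) (R1' p)"
    define m21 where "m21 = - symp_form (R2 p) (R1' p)"
    define m12 where "m12 = - symp_form (R1 p) (R2' p)"
    define m22 where "m22 = - symp_form (R2 p) (R2' p)"
    have "e * symp_form (Q1 p) (R1' p) = 1" "e * symp_form (Q2 p) (R1' p) = 0"
      "e * symp_form (Q1 p) (R2' p) = 0" "e * symp_form (Q2 p) (R2' p) = 1"
      using b' eQ[OF p] by (simp_all add: symp_form_simps)
    then have QR: "symp_form (Q1 p) (R1' p) = e" "symp_form (Q2 p) (R1' p) = 0"
      "symp_form (Q1 p) (R2' p) = 0" "symp_form (Q2 p) (R2' p) = e"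
      using e(1) by auto
    have R: "R1' p = e *\<^sub>R R1 p + m11 *\<^sub>R Q1 p + m21 *\<^sub>R Q2 p"
        "R2' p = e *\<^sub>R R2 p + m12 *\<^sub>R Q1 p + m22 *\<^sub>R Q2 p"
      using symplectic_basis_expand[OF B, of "R1' p"] symplectic_basis_expand[OF B, of "R2' p"]
      by (simp_all add: QR m11_def m12_def m21_def m22_def algebra_simps)
    have "symp_form (R1' p) (R2' p) = 0" using b' by simp
    then have sym: "m12 = m21"
      unfolding R using e(1) by (auto simp: symp_form_simps b)
    have na: "normal_alpha (R1 p) (R2 p) d1 d2"
      using alpha[OF p] by (simp add: d1_def d2_def)
    have na': "normal_alpha (R1' p) (R2' p) (\<lambda>\<zeta>. e *\<^sub>R d1 \<zeta>) (\<lambda>\<zeta>. e *\<^sub>R d2 \<zeta>)"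
      using alpha'[OF p] by (simp add: d')
    have "symp_form (e *\<^sub>R r + k *\<^sub>R Q1 p + l *\<^sub>R Q2 p) (e *\<^sub>R y) =
        symp_form r y + e * (k * symp_form (Q1 p) y + l * symp_form (Q2 p) y)" for r y k l
      using e(1) by (auto simp: symp_form_simps)
    then have R': "symp_form (R1' p) (e *\<^sub>R y) =
        symp_form (R1 p) y + e * (m11 * symp_form (Q1 p) y + m21 * symp_form (Q2 p) y)"
      "symp_form (R2' p) (e *\<^sub>R y) = symp_form (R2 p) y + e * (m12 * symp_form (Q1 p) y + m22 * symp_form (Q2 p) y)" for y
      unfolding R by simp_all
    \<comment> \<open>Subtracting the conditions for the two frames leaves only the m's. At
      \<open>\<zeta>\<close> = 1 the trace gives m11 = m22 and the skew part m12 = -m21; the type of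
      \<eta> gives m11 = -m22. With symmetry all vanish.\<close>
    have "e * (m11 - m22) = 0" "e * (m12 + m21) = 0"
      using conjunct1[OF na[unfolded normal_alpha_def], rule_format, of 1]
        conjunct1[OF na'[unfolded normal_alpha_def R' g], rule_format, of 1]
      by (auto simp: algebra_simps)
    moreover have "e * (m11 + m22) = 0"
      using conjunct2[OF na[unfolded normal_alpha_def]] conjunct2[OF na'[unfolded normal_alpha_def R' g]]
      by (simp add: algebra_simps)
    ultimately have "m11 = m22 \<and> m12 = - m21 \<and> m11 + m22 = 0"
      using e(1) by auto
    then have "m11 = 0" "m12 = 0" "m21 = 0" "m22 = 0" using sym by auto
    then show ?thesis unfolding R by simp
  qed
  then show ?thesis
    using e(1) eQ by blast
qed

section \<open>Frames over a complex chart\<close>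

lemma aff_in_affine_symplectic [simp]: "aff P X \<in> affine_symplectic \<longleftrightarrow> X \<in> Sp4"
  unfolding affine_symplectic_def using lin_part_aff by auto metis

lemma smooth_on_aff:
  assumes "open D" "smooth_on D P" "smooth_on D X"
  shows "smooth_on D (\<lambda>p. aff (P p) (X p))"
proof (intro smooth_on_vec assms(1))
  fix i j :: "1 + 4"
  show "smooth_on D (\<lambda>p. aff (P p) (X p) $ i $ j)"
    by (cases i; cases j) (auto simp: aff_def intro!: smooth_on_vec_nth assms)
qed

lemma smooth_on_lin_part:
  assumes "open D" "smooth_on D S"
  shows "smooth_on D (\<lambda>p. lin_part (S p))"
proof (intro smooth_on_vec assms(1))
  fix i j
  show "smooth_on D (\<lambda>p. lin_part (S p) $ i $ j)"
    by (simp add: lin_part_def smooth_on_vec_nth assms)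
qed

lemma smooth_on_cols4:
  assumes "open D" "smooth_on D X1" "smooth_on D X2" "smooth_on D X3" "smooth_on D X4"
  shows "smooth_on D (\<lambda>p. cols4 (X1 p) (X2 p) (X3 p) (X4 p))"
proof (intro smooth_on_vec assms(1))
  fix i j :: 4
  show "smooth_on D (\<lambda>p. cols4 (X1 p) (X2 p) (X3 p) (X4 p) $ i $ j)"
    using exhaust_4[of j] by (auto simp: cols4_def intro!: smooth_on_vec_nth assms)
qed

lemma bounded_linear_column: "bounded_linear (column j :: real^4^4 \<Rightarrow> real^4)"
  by (rule linear_conv_bounded_linear[THEN iffD1]) (auto intro!: linearI simp: column_def vec_eq_iff)

lemma smooth_on_column: "open D \<Longrightarrow> smooth_on D X \<Longrightarrow> smooth_on D (\<lambda>p. column j (X p :: real^4^4))"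
  by (rule smooth_on_bounded_linear[OF bounded_linear_column])

lemma column_frechet_derivative:
  assumes "smooth_on D X" "p \<in> D"
  shows "column j (frechet_derivative X (at p) v :: real^4^4) =
      frechet_derivative (\<lambda>p. column j (X p)) (at p) v"
  using frechet_derivative_eqI[OF bounded_linear.has_derivative[OF bounded_linear_column
        smooth_on_has_derivative[OF assms]], of j] by simp

lemma columns_4_eqI:
  fixes X Y :: "real^4^4"
  assumes "column 1 X = column 1 Y" "column 2 X = column 2 Y" "column 3 X = column 3 Y"
      "column 4 X = column 4 Y"
  shows "X = Y"
  using assms by (auto simp: vec_eq_iff column_def forall_4)

text \<open>The rows of the inverse of a symplectic matrix are pairings with its columns. This turns
  the entries of \<open>theta\<close> into values of \<Omega>.\<close>

lemma Sp4_matrix_inv_mult: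
  assumes "X \<in> Sp4"
  shows "(matrix_inv X ** Y) $ 1 $ j = - symp_form (column 3 X) (column j Y)"
    "(matrix_inv X ** Y) $ 2 $ j = - symp_form (column 4 X) (column j Y)"
    "(matrix_inv X ** Y) $ 3 $ j = symp_form (column 1 X) (column j Y)"
    "(matrix_inv X ** Y) $ 4 $ j = symp_form (column 2 X) (column j Y)"
proof -
  define T where "T = matrix_inv X ** Y"
  have "invertible X" using assms by (simp add: Sp4_def)
  then have "X ** matrix_inv X = mat 1"
    unfolding invertible_def matrix_inv_def by (rule someI2_ex) simp
  then have "X ** T = Y"
    unfolding T_def by (simp add: matrix_mul_assoc)
  then have "column j Y = T $ 1 $ j *\<^sub>R column 1 X + T $ 2 $ j *\<^sub>R column 2 X + T $ 3 $ j *\<^sub>R column 3 X + T $ 4 $ j *\<^sub>R column 4 X"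
    by (auto simp: vec_eq_iff column_def matrix_matrix_mult_def sum_4 mult.commute)
  then show "(matrix_inv X ** Y) $ 1 $ j = - symp_form (column 3 X) (column j Y)"
    "(matrix_inv X ** Y) $ 2 $ j = - symp_form (column 4 X) (column j Y)"
    "(matrix_inv X ** Y) $ 3 $ j = symp_form (column 1 X) (column j Y)"
    "(matrix_inv X ** Y) $ 4 $ j = symp_form (column 2 X) (column j Y)"
    unfolding T_def[symmetric] using symplectic_basisD[OF assms[unfolded Sp4_iff]]
    by (simp_all add: symp_form_simps)
qed

section \<open>Oriented planes and change of basis\<close>

lemma oriented_plane_subset:
  assumes "a * d - b * c > 0"
  shows "oriented_plane (a *\<^sub>R x + b *\<^sub>R y) (c *\<^sub>R x + d *\<^sub>R y) \<subseteq> oriented_plane x y"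
proof
  fix P assume "P \<in> oriented_plane (a *\<^sub>R x + b *\<^sub>R y) (c *\<^sub>R x + d *\<^sub>R y)"
  then obtain k l m n where kl: "k * n - l * m > 0" and
    P: "P = (k *\<^sub>R (a *\<^sub>R x + b *\<^sub>R y) + l *\<^sub>R (c *\<^sub>R x + d *\<^sub>R y), m *\<^sub>R (a *\<^sub>R x + b *\<^sub>R y) + n *\<^sub>R (c *\<^sub>R x + d *\<^sub>R y))"
    by (auto simp: oriented_plane_def)
  have "P = ((k * a + l * c) *\<^sub>R x + (k * b + l * d) *\<^sub>R y, (m * a + n * c) *\<^sub>R x + (m * b + n * d) *\<^sub>R y)"
    by (simp add: P algebra_simps)
  moreover have "(k * a + l * c) * (m * b + n * d) - (k * b + l * d) * (m * a + n * c) =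
      (k * n - l * m) * (a * d - b * c)"
    by (simp add: algebra_simps)
  then have "(k * a + l * c) * (m * b + n * d) - (k * b + l * d) * (m * a + n * c) > 0"
    using assms kl by simp
  ultimately show "P \<in> oriented_plane x y"
    unfolding oriented_plane_def by blast
qed

lemma oriented_plane_eq_iff:
  "oriented_plane x y = oriented_plane x' y' \<longleftrightarrow>
    (\<exists>a b c d. a * d - b * c > 0 \<and> x' = a *\<^sub>R x + b *\<^sub>R y \<and> y' = c *\<^sub>R x + d *\<^sub>R y)"
proof
  assume "oriented_plane x y = oriented_plane x' y'"
  moreover have "(x', y') = (1 *\<^sub>R x' + 0 *\<^sub>R y', 0 *\<^sub>R x' + 1 *\<^sub>R y')" "1 * 1 - 0 * 0 > (0::real)"
      by simp_all
  then have "(x', y') \<in> oriented_plane x' y'"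
    unfolding oriented_plane_def by blast
  ultimately have "(x', y') \<in> oriented_plane x y" by simp
  then show "\<exists>a b c d. a * d - b * c > 0 \<and> x' = a *\<^sub>R x + b *\<^sub>R y \<and> y' = c *\<^sub>R x + d *\<^sub>R y"
    unfolding oriented_plane_def by blast
next
  assume "\<exists>a b c d. a * d - b * c > 0 \<and> x' = a *\<^sub>R x + b *\<^sub>R y \<and> y' = c *\<^sub>R x + d *\<^sub>R y"
  then obtain a b c d where det: "a * d - b * c > 0" and xy: "x' = a *\<^sub>R x + b *\<^sub>R y" "y' = c *\<^sub>R x + d *\<^sub>R y"
    by blast
  \<comment> \<open>The inverse coefficient matrix, by Cramer's rule; its determinant 1 / e is again
    positive.\<close>
  define e where "e = a * d - b * c"
  have e: "e > 0" using det by (simp add: e_def)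
  have "(d / e) *\<^sub>R x' + (- b / e) *\<^sub>R y' = ((d * a - b * c) / e) *\<^sub>R x"
    unfolding xy by (simp add: algebra_simps diff_divide_distrib)
  then have x: "x = (d / e) *\<^sub>R x' + (- b / e) *\<^sub>R y'"
    using e by (simp add: e_def mult.commute)
  have "(- c / e) *\<^sub>R x' + (a / e) *\<^sub>R y' = ((a * d - b * c) / e) *\<^sub>R y"
    unfolding xy by (simp add: algebra_simps diff_divide_distrib)
  then have y: "y = (- c / e) *\<^sub>R x' + (a / e) *\<^sub>R y'"
    using e by (simp add: e_def mult.commute)
  have "(d / e) * (a / e) - (- b / e) * (- c / e) = (a * d - b * c) / (e * e)"
    by (simp add: diff_divide_distrib mult.commute)
  then have "(d / e) * (a / e) - (- b / e) * (- c / e) > 0"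
    using e det by simp
  from oriented_plane_subset[OF this, of x' y'] have "oriented_plane x y \<subseteq> oriented_plane x' y'"
    unfolding x[symmetric] y[symmetric] .
  moreover have "oriented_plane x' y' \<subseteq> oriented_plane x y"
    unfolding xy by (rule oriented_plane_subset[OF det])
  ultimately show "oriented_plane x y = oriented_plane x' y'" by blast
qed

locale lagrangian_complex_chart = positive_complex_chart A U z
  for A :: "'m::{t2_space,second_countable_topology} chart set" and U z +
  fixes f :: "'m \<Rightarrow> real^4"
  assumes lagrangian: "lagrangian_immersion A f"
    and connected_U: "connected U"
begin

abbreviation "D \<equiv> z ` U"

definition F :: "complex \<Rightarrow> real^4" where "F = f \<circ> z_inv"

definition Fx :: "complex \<Rightarrow> real^4" where "Fx p = frechet_derivative F (at p) 1"

definition Fy :: "complex \<Rightarrow> real^4" where "Fy p = frechet_derivative F (at p) \<i>"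

lemma connected_D: "connected D"
  using connected_continuous_image[OF continuous_z connected_U] .

lemma smooth_map_f: "smooth_map A U f"
proof -
  have "smooth_on (snd c ` (fst c \<inter> U)) (coord_rep c f)" if "c \<in> A" for c
    by (rule smooth_on_subset[of "snd c ` fst c"])
      (use lagrangian that in \<open>auto simp: lagrangian_immersion_def smooth_map_def\<close>)
  then show ?thesis by (simp add: smooth_map_def)
qed

lemma smooth_F: "smooth_on D F"
  using smooth_map_f unfolding smooth_map_iff F_def .

lemma smooth_Fx: "smooth_on D Fx" and smooth_Fy: "smooth_on D Fy"
  unfolding Fx_def Fy_def by (rule smooth_on_frechet_derivative[OF smooth_F])+

lemma tdiff_f:
  assumes "q \<in> U"
  shows "tdiff A f q v = Im (tdiff A z q v) *\<^sub>R Fy (z q) + Re (tdiff A z q v) *\<^sub>R Fx (z q)"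
  unfolding tdiff_z_inv[OF smooth_map_f assms] F_def[symmetric] Fx_def Fy_def
  by (subst smooth_on_expansion[OF smooth_F]) (use assms in \<open>auto simp: add.commute\<close>)

lemma lagrangian_F:
  assumes "p \<in> D"
  shows "symp_form (Fx p) (Fy p) = 0"
proof -
  obtain q where q: "q \<in> U" "p = z q" using assms by blast
  obtain v w where v: "v \<in> tangent_space A q" "tdiff A z q v = 1" and w: "w \<in> tangent_space A q"
      "tdiff A z q w = \<i>"
    using exists_tdiff_z[OF q(1)] by metis
  have "symp_form (tdiff A f q v) (tdiff A f q w) = 0"
    using lagrangian v(1) w(1) by (simp add: lagrangian_immersion_def)
  then show ?thesis
    by (simp add: tdiff_f q v w)
qed

lemma independent_F:
  assumes "p \<in> D" "a *\<^sub>R Fy p + b *\<^sub>R Fx p = 0"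
  shows "a = 0 \<and> b = 0"
proof -
  obtain q where q: "q \<in> U" "p = z q" using assms(1) by blast
  obtain v w where v: "v \<in> tangent_space A q" "tdiff A z q v = Complex b a" and w: "w \<in> tangent_space A q"
      "tdiff A z q w = 0"
    using exists_tdiff_z[OF q(1)] by metis
  have "tdiff A f q v = tdiff A f q w"
    using assms(2) by (simp add: tdiff_f q v w)
  then have "v = w"
    using lagrangian v(1) w(1) by (auto simp: lagrangian_immersion_def inj_on_def)
  then have "Complex b a = 0" using v w by simp
  then show ?thesis by (simp add: complex_eq_iff)
qed

text \<open>(F_x, F_y) is positive on the surface, so the swap in \<open>gauss_map\<close> makes
  (F_y, F_x) the positive basis.\<close>

lemma gauss_map_eq:
  assumes q: "q \<in> U"
  shows "gauss_map A f q = oriented_plane (Fy (z q)) (Fx (z q))"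
proof (intro equalityI subsetI)
  fix P assume "P \<in> gauss_map A f q"
  then obtain v w where pos: "pos_basis A q v w" and P: "P = (tdiff A f q w, tdiff A f q v)"
    by (auto simp: gauss_map_def)
  have "Im (tdiff A z q w) * Re (tdiff A z q v) - Re (tdiff A z q w) * Im (tdiff A z q v) > 0"
    using positive[OF q pos] by (simp add: algebra_simps)
  then show "P \<in> oriented_plane (Fy (z q)) (Fx (z q))"
    unfolding oriented_plane_def P tdiff_f[OF q] by blast
next
  fix P assume "P \<in> oriented_plane (Fy (z q)) (Fx (z q))"
  then obtain a b c d where det: "a * d - b * c > 0" and
    P: "P = (a *\<^sub>R Fy (z q) + b *\<^sub>R Fx (z q), c *\<^sub>R Fy (z q) + d *\<^sub>R Fx (z q))"
    by (auto simp: oriented_plane_def)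
  obtain v w where v: "v \<in> tangent_space A q" "tdiff A z q v = Complex d c"
    and w: "w \<in> tangent_space A q" "tdiff A z q w = Complex b a"
    using exists_tdiff_z[OF q] by metis
  have "pos_basis A q v w"
    unfolding pos_basis_iff[OF q v(1) w(1)] v(2) w(2) using det by (simp add: algebra_simps)
  then show "P \<in> gauss_map A f q"
    unfolding gauss_map_def P by (intro CollectI exI[of _ v] exI[of _ w]) (simp add: tdiff_f[OF q] v w)
qed

definition tangent_columns :: "(complex \<Rightarrow> real^4^4) \<Rightarrow> bool" where
  "tangent_columns X \<longleftrightarrow> (\<forall>p\<in>D. oriented_plane (Fy p) (Fx p) = oriented_plane (column 1 (X p)) (column 2 (X p)))"

context
  fixes X :: "complex \<Rightarrow> real^4^4" and Y :: "'m \<Rightarrow> real^4^4"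
  assumes Y: "\<forall>q\<in>U. Y q = X (z q)"
begin

text \<open>The frame is Y on the surface and X on the plane, tied together on U only. This serves
  both uses: existence starts from X and takes Y = X o z, uniqueness starts from Y and takes X = Y o
  \<open>z_inv\<close>.\<close>

lemma smooth_map_frame_iff: "smooth_map A U (\<lambda>q. aff (f q) (Y q)) \<longleftrightarrow> smooth_on D X"
proof -
  have eq: "((\<lambda>q. aff (f q) (Y q)) \<circ> z_inv) p = aff (F p) (X p)" if "p \<in> D" for p
    using that z_inv_in[OF that] z_z_inv[OF that] by (simp add: F_def Y)
  have "smooth_on D (\<lambda>p. aff (F p) (X p))" if "smooth_on D ((\<lambda>q. aff (f q) (Y q)) \<circ> z_inv)"
    by (rule smooth_on_cong[OF open_D _ that]) (rule eq)
  moreover have "smooth_on D ((\<lambda>q. aff (f q) (Y q)) \<circ> z_inv)" if "smooth_on D (\<lambda>p. aff (F p) (X p))"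
    by (rule smooth_on_cong[OF open_D _ that]) (rule eq[symmetric])
  moreover have "smooth_on D X" if "smooth_on D (\<lambda>p. aff (F p) (X p))"
    using smooth_on_lin_part[OF open_D that] by (simp add: lin_part_aff)
  ultimately show ?thesis
    unfolding smooth_map_iff using smooth_on_aff[OF open_D smooth_F] by blast
qed

lemma first_order_frame_iff:
  "first_order A f U (\<lambda>q. aff (f q) (Y q)) \<longleftrightarrow> smooth_on D X \<and> (\<forall>p\<in>D. X p \<in> Sp4) \<and> tangent_columns X"
  unfolding first_order_def symplectic_frame_def smooth_map_frame_iff tangent_columns_def
  using open_U connected_U by (auto simp: point_part_aff lin_part_aff gauss_map_eq Y)

context
  assumes X: "smooth_on D X" "\<forall>p\<in>D. X p \<in> Sp4"
begin

lemma theta_frame: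
  assumes q: "q \<in> U"
  shows "theta A (\<lambda>q. aff (f q) (Y q)) q v =
      matrix_inv (X (z q)) ** frechet_derivative X (at (z q)) (tdiff A z q v)"
proof -
  have eq: "(Y \<circ> z_inv) p = X p" if "p \<in> D" for p
    using z_inv_in[OF that] z_z_inv[OF that] by (simp add: Y)
  have sY: "smooth_map A U Y"
    unfolding smooth_map_iff by (rule smooth_on_cong[OF open_D _ X(1)]) (rule eq[symmetric])
  have "(X has_derivative frechet_derivative X (at (z q))) (at (z q))"
    by (rule smooth_on_has_derivative[OF X(1)]) (use q in simp)
  then have "((Y \<circ> z_inv) has_derivative frechet_derivative X (at (z q))) (at (z q))"
    by (rule has_derivative_transform_within_open[OF _ open_D]) (use q eq in auto)
  then show ?thesis
    by (simp add: theta_def lin_part_aff bspec[OF Y q] tdiff_z_inv[OF sY q] frechet_derivative_eqI)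
qed

lemma frame_forms:
  fixes v :: "'m tvec"
  assumes q: "q \<in> U"
  defines "d j \<equiv> frechet_derivative (\<lambda>p. column j (X p)) (at (z q)) (tdiff A z q v)"
  defines "x j \<equiv> column j (X (z q))"
  shows "gamma A (\<lambda>q. aff (f q) (Y q)) 1 1 q v = symp_form (x 1) (d 1)"
    "gamma A (\<lambda>q. aff (f q) (Y q)) 2 1 q v = symp_form (x 2) (d 1)"
    "gamma A (\<lambda>q. aff (f q) (Y q)) 2 2 q v = symp_form (x 2) (d 2)"
    "alpha A (\<lambda>q. aff (f q) (Y q)) 1 1 q v = - symp_form (x 3) (d 1)"
    "alpha A (\<lambda>q. aff (f q) (Y q)) 1 2 q v = - symp_form (x 3) (d 2)"
    "alpha A (\<lambda>q. aff (f q) (Y q)) 2 1 q v = - symp_form (x 4) (d 1)"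
    "alpha A (\<lambda>q. aff (f q) (Y q)) 2 2 q v = - symp_form (x 4) (d 2)"
proof -
  have p: "z q \<in> D" using q by simp
  show "gamma A (\<lambda>q. aff (f q) (Y q)) 1 1 q v = symp_form (x 1) (d 1)"
    "gamma A (\<lambda>q. aff (f q) (Y q)) 2 1 q v = symp_form (x 2) (d 1)"
    "gamma A (\<lambda>q. aff (f q) (Y q)) 2 2 q v = symp_form (x 2) (d 2)"
    "alpha A (\<lambda>q. aff (f q) (Y q)) 1 1 q v = - symp_form (x 3) (d 1)"
    "alpha A (\<lambda>q. aff (f q) (Y q)) 1 2 q v = - symp_form (x 3) (d 2)"
    "alpha A (\<lambda>q. aff (f q) (Y q)) 2 1 q v = - symp_form (x 4) (d 1)"
    "alpha A (\<lambda>q. aff (f q) (Y q)) 2 2 q v = - symp_form (x 4) (d 2)"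
    unfolding gamma_def alpha_def theta_frame[OF q] d_def x_def column_frechet_derivative[OF X(1) p, symmetric]
    by (simp_all add: Sp4_matrix_inv_mult[OF bspec[OF X(2) p]])
qed

end

text \<open>As dz is onto, identities for all tangent vectors at q are identities for all complex
  \<open>\<zeta>\<close>. The functions \<open>h\<close> and \<open>l\<close> disappear:
  \<open>l\<close> = 0 means that \<eta> is complex linear, which is tested on 1 and
  \<open>\<i>\<close>.\<close>

lemma adapted_frame_iff:
  "adapted_frame A f U z (\<lambda>q. aff (f q) (Y q)) \<longleftrightarrow>
     smooth_on D X \<and> (\<forall>p\<in>D. X p \<in> Sp4) \<and> tangent_columns X \<and>
     (\<forall>p\<in>D. normal_gamma (column 1 (X p)) (column 2 (X p))
        (frechet_derivative (\<lambda>p. column 1 (X p)) (at p)) (frechet_derivative (\<lambda>p. column 2 (X p)) (at p)) \<and>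
      normal_alpha (column 3 (X p)) (column 4 (X p))
        (frechet_derivative (\<lambda>p. column 1 (X p)) (at p)) (frechet_derivative (\<lambda>p. column 2 (X p)) (at p)))"
  (is "?lhs \<longleftrightarrow> ?fo \<and> ?Sp \<and> ?tan \<and> (\<forall>p\<in>D. ?g p \<and> ?a p)")
proof (cases "?fo \<and> ?Sp \<and> ?tan")
  case False
  then show ?thesis
    using first_order_frame_iff by (auto simp: adapted_frame_def third_order_def second_order_def)
next
  case True
  let ?S = "\<lambda>q. aff (f q) (Y q)"
  have X: "smooth_on D X" "\<forall>p\<in>D. X p \<in> Sp4" using True by auto
  note forms = frame_forms[OF X]
  have fo: "first_order A f U ?S" using True first_order_frame_iff by blast
  show ?thesis
  proof (intro iffI conjI ballI)
    assume L: ?lhs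
    fix p assume "p \<in> D"
    then obtain q where q: "q \<in> U" and p: "p = z q" by blast
    \<comment> \<open>A right inverse of dz at q, merely as a function.\<close>
    obtain t :: "complex \<Rightarrow> 'm tvec" where t: "\<And>\<zeta>. t \<zeta> \<in> tangent_space A q" "\<And>\<zeta>. tdiff A z q (t \<zeta>) = \<zeta>"
      using exists_tdiff_z[OF q] by metis
    from L obtain h l where "\<And>v. v \<in> tangent_space A q \<Longrightarrow>
        eta A ?S q v = h q * omega A ?S q v + complex_of_real (l q) * cnj (omega A ?S q v)" "l q = 0"
      using q unfolding adapted_frame_def third_order_def by blast
    then have h: "\<And>v. v \<in> tangent_space A q \<Longrightarrow> eta A ?S q v = h q * omega A ?S q v"
      by simp
    from L have o: "\<And>v. v \<in> tangent_space A q \<Longrightarrow> omega A ?S q v = tdiff A z q v"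
      and g: "\<And>v. v \<in> tangent_space A q \<Longrightarrow> gamma A ?S 1 1 q v + gamma A ?S 2 2 q v = 0"
      and a: "\<And>v. v \<in> tangent_space A q \<Longrightarrow> alpha A ?S 1 1 q v + alpha A ?S 2 2 q v = 0"
        "\<And>v. v \<in> tangent_space A q \<Longrightarrow> alpha A ?S 2 1 q v - alpha A ?S 1 2 q v = 0"
      using q unfolding adapted_frame_def third_order_def second_order_def by blast+
    have "gamma A ?S 1 1 q (t \<zeta>) = Re \<zeta> \<and> gamma A ?S 2 1 q (t \<zeta>) = Im \<zeta> \<and> gamma A ?S 2 2 q (t \<zeta>) = - Re \<zeta>"
        for \<zeta>
      using o[OF t(1)[of \<zeta>]] g[OF t(1)[of \<zeta>]] unfolding t(2) omega_def by (auto simp: complex_eq_iff)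
    then show "?g p"
      unfolding forms[OF q] t(2) normal_gamma_def p by blast
    have "eta A ?S q (t \<i>) = \<i> * eta A ?S q (t 1)"
      using h[OF t(1)] o[OF t(1)] t(2) by simp
    then have "Re (eta A ?S q (t \<i>)) = - Im (eta A ?S q (t 1))"
        "Im (eta A ?S q (t \<i>)) = Re (eta A ?S q (t 1))"
      by simp_all
    moreover have "x / 2 = - (- y / 2) \<Longrightarrow> x = y" "- y / 2 = x / 2 \<Longrightarrow> - y = x" for x y :: real
      by simp_all
    ultimately have e: "alpha A ?S 1 1 q (t \<i>) - alpha A ?S 2 2 q (t \<i>) =
        alpha A ?S 2 1 q (t 1) + alpha A ?S 1 2 q (t 1)"
      "- (alpha A ?S 2 1 q (t \<i>) + alpha A ?S 1 2 q (t \<i>)) = alpha A ?S 1 1 q (t 1) - alpha A ?S 2 2 q (t 1)"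
      unfolding eta_def complex.sel by blast+
    let ?r = "\<lambda>j. column j (X (z q))" and ?d = "\<lambda>j. frechet_derivative (\<lambda>p. column j (X p)) (at (z q))"
    have "symp_form (?r 3) (?d 1 \<zeta>) + symp_form (?r 4) (?d 2 \<zeta>) = 0"
      "symp_form (?r 4) (?d 1 \<zeta>) = symp_form (?r 3) (?d 2 \<zeta>)" for \<zeta>
      using a[OF t(1)[of \<zeta>]] unfolding forms[OF q] t(2) by - linarith+
    moreover have "symp_form (?r 3) (?d 1 \<i>) - symp_form (?r 4) (?d 2 \<i>) =
        symp_form (?r 4) (?d 1 1) + symp_form (?r 3) (?d 2 1)"
      "symp_form (?r 4) (?d 1 \<i>) + symp_form (?r 3) (?d 2 \<i>) =
        - (symp_form (?r 3) (?d 1 1) - symp_form (?r 4) (?d 2 1))"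
      using e unfolding forms[OF q] t(2) by - linarith+
    ultimately show "?a p"
      unfolding normal_alpha_def p by blast
  next
    assume R: "?fo \<and> ?Sp \<and> ?tan \<and> (\<forall>p\<in>D. ?g p \<and> ?a p)"
    have g: "gamma A ?S 1 1 q v = Re (tdiff A z q v)" "gamma A ?S 2 1 q v = Im (tdiff A z q v)"
      "gamma A ?S 2 2 q v = - Re (tdiff A z q v)" if q: "q \<in> U" for q v
      using R q unfolding forms[OF q] normal_gamma_def by auto
    have o: "omega A ?S q v = tdiff A z q v" if q: "q \<in> U" for q v
      by (simp add: omega_def g[OF q])
    have a: "alpha A ?S 1 1 q v + alpha A ?S 2 2 q v = 0" "alpha A ?S 2 1 q v - alpha A ?S 1 2 q v = 0"
      if q: "q \<in> U" for q v
    proof -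
      have "?a (z q)" using R q by blast
      from conjunct1[OF this[unfolded normal_alpha_def], rule_format, of "tdiff A z q v"]
      show "alpha A ?S 1 1 q v + alpha A ?S 2 2 q v = 0" "alpha A ?S 2 1 q v - alpha A ?S 1 2 q v = 0"
        unfolding forms[OF q] by - linarith+
    qed
    \<comment> \<open>Conversely, a complex linear form is multiplication by its value at 1; this
      value is \<open>h\<close>.\<close>
    have "\<exists>h. \<forall>v. eta A ?S q v = h * omega A ?S q v" if q: "q \<in> U" for q
    proof -
      define d where "d j = frechet_derivative (\<lambda>p. column j (X p)) (at (z q))" for j
      define e where "e \<zeta> = Complex (- (symp_form (column 3 (X (z q))) (d 1 \<zeta>) - symp_form (column 4 (X (z q))) (d 2 \<zeta>)) / 2)
        ((symp_form (column 4 (X (z q))) (d 1 \<zeta>) + symp_form (column 3 (X (z q))) (d 2 \<zeta>)) / 2)" for \<zeta>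
      have "normal_alpha (column 3 (X (z q))) (column 4 (X (z q))) (d 1) (d 2)"
        using R q by (simp add: d_def)
      from conjunct2[OF this[unfolded normal_alpha_def]] have ei: "e \<i> = \<i> * e 1"
        by (simp add: e_def complex_eq_iff add_divide_distrib)
      have dl: "d j \<zeta> = Re \<zeta> *\<^sub>R d j 1 + Im \<zeta> *\<^sub>R d j \<i>" for j \<zeta>
        unfolding d_def by (rule smooth_on_expansion[OF smooth_on_column[OF open_D X(1)]]) (use q in simp)
      have lin: "e \<zeta> = Re \<zeta> *\<^sub>R e 1 + Im \<zeta> *\<^sub>R e \<i>" for \<zeta>
        unfolding e_def dl[of _ \<zeta>] by (simp add: complex_eq_iff symp_form_simps field_simps)
      have e1: "e \<zeta> = e 1 * \<zeta>" for \<zeta>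
        unfolding lin[of \<zeta>] ei by (simp add: complex_eq_iff algebra_simps)
      have "eta A ?S q v = e (tdiff A z q v)" for v
        unfolding eta_def forms[OF q] e_def d_def by simp
      then have "eta A ?S q v = e 1 * omega A ?S q v" for v
        unfolding o[OF q] e1[of "tdiff A z q v", symmetric] .
      then show ?thesis by blast
    qed
    then have "\<forall>q\<in>U. \<exists>h. \<forall>v. eta A ?S q v = h * omega A ?S q v" by blast
    from bchoice[OF this] obtain h where "\<forall>q\<in>U. \<forall>v. eta A ?S q v = h q * omega A ?S q v" ..
    then have "third_order A f U ?S"
      unfolding third_order_def second_order_def using fo g
          by (auto intro!: exI[of _ h] exI[of _ "\<lambda>_. 0 :: real"])
    then show ?lhs
      unfolding adapted_frame_def using o a by auto
  qed (use True in auto)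
qed

end

text \<open>Conformality of z is stated for arbitrary first order frames, so it says something about
  F only once such a frame is exhibited over U.\<close>

lemma exists_first_order_frame:
  "\<exists>X. smooth_on D X \<and> (\<forall>p\<in>D. X p \<in> Sp4) \<and> (\<forall>p. column 1 (X p) = Fy p \<and> column 2 (X p) = Fx p)"
proof -
  have "symp_form (Fy p) (Fx p) = 0" if "p \<in> D" for p
    using lagrangian_F[OF that] symp_form_skew[of "Fy p" "Fx p"] by simp
  then obtain R1 R2 where R: "smooth_on D R1" "smooth_on D R2"
    and basis: "\<And>p. p \<in> D \<Longrightarrow> symplectic_basis (Fy p) (Fx p) (R1 p) (R2 p)"
    using smooth_lagrangian_complement[OF open_D smooth_Fy smooth_Fx] independent_F by metis
  then show ?thesis
    by (intro exI[of _ "\<lambda>p. cols4 (Fy p) (Fx p) (R1 p) (R2 p)"])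
      (auto simp: Sp4_iff intro!: smooth_on_cols4 open_D smooth_Fx smooth_Fy)
qed

lemma conformal_F:
  assumes conf: "\<And>S q. first_order A f U S \<Longrightarrow> q \<in> U \<Longrightarrow>
      \<exists>r>0. \<forall>v\<in>tangent_space A q. gform A S q v = r * (cmod (tdiff A z q v))\<^sup>2"
    and p: "p \<in> D"
  shows "\<exists>r>0. \<forall>\<zeta>.
      - symp_form (Fy p) (frechet_derivative Fy (at p) \<zeta>) * symp_form (Fx p) (frechet_derivative Fx (at p) \<zeta>)
      + (symp_form (Fx p) (frechet_derivative Fy (at p) \<zeta>))\<^sup>2 = r * (cmod \<zeta>)\<^sup>2"
proof -
  obtain q where q: "q \<in> U" and pq: "p = z q" using p by blast
  obtain X where X: "smooth_on D X" "\<forall>p\<in>D. X p \<in> Sp4"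
    and cols: "\<And>p. column 1 (X p) = Fy p" "\<And>p. column 2 (X p) = Fx p"
    using exists_first_order_frame by metis
  let ?S = "\<lambda>q. aff (f q) (X (z q))"
  have "first_order A f U ?S"
    using first_order_frame_iff[of "\<lambda>q. X (z q)" X] X by (simp add: tangent_columns_def cols)
  from conf[OF this q] obtain r where r: "r > 0" "\<And>v. v \<in> tangent_space A q \<Longrightarrow>
      gform A ?S q v = r * (cmod (tdiff A z q v))\<^sup>2"
    by blast
  show ?thesis
  proof (intro exI[of _ r] conjI allI r(1))
    fix \<zeta>
    obtain v where v: "v \<in> tangent_space A q" "tdiff A z q v = \<zeta>"
      using exists_tdiff_z[OF q] by blast
    show "- symp_form (Fy p) (frechet_derivative Fy (at p) \<zeta>) * symp_form (Fx p) (frechet_derivative Fx (at p) \<zeta>)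
      + (symp_form (Fx p) (frechet_derivative Fy (at p) \<zeta>))\<^sup>2 = r * (cmod \<zeta>)\<^sup>2"
      using r(2)[OF v(1)] frame_forms(1-3)[where Y = "\<lambda>q. X (z q)" and X = X
          and v = v, OF _ X q] unfolding gform_def v(2)
      by (simp add: cols pq)
  qed
qed

lemma exists_adapted_frame:
  assumes "contractible U"
    and conf: "\<And>S q. first_order A f U S \<Longrightarrow> q \<in> U \<Longrightarrow>
      \<exists>r>0. \<forall>v\<in>tangent_space A q. gform A S q v = r * (cmod (tdiff A z q v))\<^sup>2"
  shows "\<exists>S. adapted_frame A f U z S"
proof -
  define normal where "normal u v p \<longleftrightarrow>
     normal_gamma (u p *\<^sub>R Fy p + v p *\<^sub>R Fx p) (- v p *\<^sub>R Fy p + u p *\<^sub>R Fx p)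
       (frechet_derivative (\<lambda>p. u p *\<^sub>R Fy p + v p *\<^sub>R Fx p) (at p))
       (frechet_derivative (\<lambda>p. - v p *\<^sub>R Fy p + u p *\<^sub>R Fx p) (at p))" for u v p
  have "\<exists>u v. smooth_on D u \<and> smooth_on D v \<and> (\<forall>p\<in>D. u p * u p + v p * v p \<noteq> 0 \<and> normal u v p)"
    unfolding normal_def
    by (rule exists_normal_tangent_basis[OF open_D contractible_D[OF assms(1)] smooth_F,
        folded Fx_def Fy_def, OF lagrangian_F conformal_F[OF conf]])
  then obtain u v where uv: "smooth_on D u" "smooth_on D v" and nz: "\<And>p. p \<in> D \<Longrightarrow> u p * u p + v p * v p \<noteq> 0"
    and "\<And>p. p \<in> D \<Longrightarrow> normal u v p"
    by blast
  then have ng: "\<And>p. p \<in> D \<Longrightarrow>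
     normal_gamma (u p *\<^sub>R Fy p + v p *\<^sub>R Fx p) (- v p *\<^sub>R Fy p + u p *\<^sub>R Fx p)
       (frechet_derivative (\<lambda>p. u p *\<^sub>R Fy p + v p *\<^sub>R Fx p) (at p))
       (frechet_derivative (\<lambda>p. - v p *\<^sub>R Fy p + u p *\<^sub>R Fx p) (at p))"
    by (simp only: normal_def)
  define Q1 where "Q1 = (\<lambda>p. u p *\<^sub>R Fy p + v p *\<^sub>R Fx p)"
  define Q2 where "Q2 = (\<lambda>p. - v p *\<^sub>R Fy p + u p *\<^sub>R Fx p)"
  have Q: "smooth_on D Q1" "smooth_on D Q2"
    unfolding Q1_def Q2_def by (intro smooth_on_add smooth_on_scaleR smooth_on_minus open_D uv smooth_Fx smooth_Fy)+
  have lagr: "symp_form (Q1 p) (Q2 p) = 0" if "p \<in> D" for p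
    using lagrangian_F[OF that] symp_form_skew[of "Fy p" "Fx p"] by (simp add: Q1_def Q2_def symp_form_simps)
  have indep: "a = 0 \<and> b = 0" if "p \<in> D" "a *\<^sub>R Q1 p + b *\<^sub>R Q2 p = 0" for p a b
  proof -
    \<comment> \<open>The coefficient matrix with rows (u, v) and (-v, u) has determinant u^2 + v^2,
      nonzero here; being positive, it also preserves the orientation of the Gauss plane
      below.\<close>
    have "(a * u p - b * v p) *\<^sub>R Fy p + (a * v p + b * u p) *\<^sub>R Fx p = 0"
      using that(2) by (simp add: Q1_def Q2_def algebra_simps)
    from independent_F[OF that(1) this]
    have "a * u p - b * v p = 0" "a * v p + b * u p = 0" by auto
    moreover have "a * (u p * u p + v p * v p) = u p * (a * u p - b * v p) + v p * (a * v p + b * u p)"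
      "b * (u p * u p + v p * v p) = u p * (a * v p + b * u p) - v p * (a * u p - b * v p)"
      by (simp_all add: algebra_simps)
    ultimately show ?thesis
      using nz[OF that(1)] by auto
  qed
  have ngQ: "normal_gamma (Q1 p) (Q2 p) (frechet_derivative Q1 (at p)) (frechet_derivative Q2 (at p))"
      if "p \<in> D" for p
    using ng[OF that] by (simp only: Q1_def Q2_def)
  have "\<exists>R1 R2. smooth_on D R1 \<and> smooth_on D R2 \<and>
    (\<forall>p\<in>D. symplectic_basis (Q1 p) (Q2 p) (R1 p) (R2 p) \<and>
       normal_alpha (R1 p) (R2 p) (frechet_derivative Q1 (at p)) (frechet_derivative Q2 (at p)))"
    by (rule exists_normal_complement[OF open_D Q]) (use lagr indep ngQ in blast)+
  then obtain R1 R2 where R: "smooth_on D R1" "smooth_on D R2"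
    and basis: "\<And>p. p \<in> D \<Longrightarrow> symplectic_basis (Q1 p) (Q2 p) (R1 p) (R2 p)"
    and na: "\<And>p. p \<in> D \<Longrightarrow> normal_alpha (R1 p) (R2 p) (frechet_derivative Q1 (at p)) (frechet_derivative Q2 (at p))"
    by blast
  define X where "X p = cols4 (Q1 p) (Q2 p) (R1 p) (R2 p)" for p
  have "tangent_columns X"
    unfolding tangent_columns_def oriented_plane_eq_iff
  proof
    fix p assume "p \<in> D"
    have "u p * u p - v p * (- v p) > 0"
      using nz[OF \<open>p \<in> D\<close>] by (simp add: sum_squares_gt_zero_iff)
    then show "\<exists>a b c d. 0 < a * d - b * c \<and> column 1 (X p) = a *\<^sub>R Fy p + b *\<^sub>R Fx p \<and>
        column 2 (X p) = c *\<^sub>R Fy p + d *\<^sub>R Fx p"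
      unfolding X_def column_cols4 Q1_def Q2_def by blast
  qed
  moreover have "smooth_on D X"
    unfolding X_def by (intro smooth_on_cols4 open_D Q R)
  ultimately have "adapted_frame A f U z (\<lambda>q. aff (f q) (X (z q)))"
    by (subst adapted_frame_iff[where X = X
        and Y = "\<lambda>q. X (z q)"]) (use basis na ngQ in \<open>auto simp: X_def Sp4_iff\<close>)
  then show ?thesis by blast
qed

lemma adapted_frame_unique:
  assumes Y: "adapted_frame A f U z (\<lambda>q. aff (f q) (Y q))"
      and Y': "adapted_frame A f U z (\<lambda>q. aff (f q) (Y' q))"
  shows "(\<forall>q\<in>U. Y' q = Y q) \<or> (\<forall>q\<in>U. Y' q = - Y q)"
proof -
  define X where "X p = Y (z_inv p)" for p
  define X' where "X' p = Y' (z_inv p)" for p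
  have YX: "\<forall>q\<in>U. Y q = X (z q)" "\<forall>q\<in>U. Y' q = X' (z q)"
    using z_inv_z by (simp_all add: X_def X'_def)
  note A = Y[unfolded adapted_frame_iff[where X = X and Y = Y, OF YX(1)]]
      and A' = Y'[unfolded adapted_frame_iff[where X = X' and Y = Y', OF YX(2)]]
  have sX: "smooth_on D X" "smooth_on D X'" using A A' by auto
  \<comment> \<open>Both frames are first order for the same Gauss map, so the first two columns
    span the same plane.\<close>
  have same: "\<exists>a b c d. column 1 (X' p) = a *\<^sub>R column 1 (X p) + b *\<^sub>R column 2 (X p) \<and>
      column 2 (X' p) = c *\<^sub>R column 1 (X p) + d *\<^sub>R column 2 (X p)" if "p \<in> D" for p
  proof -
    have "oriented_plane (Fy p) (Fx p) = oriented_plane (column 1 (X p)) (column 2 (X p))"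
      "oriented_plane (Fy p) (Fx p) = oriented_plane (column 1 (X' p)) (column 2 (X' p))"
      using A A' that unfolding tangent_columns_def by blast+
    then have "oriented_plane (column 1 (X p)) (column 2 (X p)) =
        oriented_plane (column 1 (X' p)) (column 2 (X' p))"
      by (rule trans[OF sym])
    then show ?thesis unfolding oriented_plane_eq_iff by blast
  qed
  have "\<exists>e\<in>{1, -1}. \<forall>p\<in>D. column 1 (X' p) = e *\<^sub>R column 1 (X p) \<and> column 2 (X' p) = e *\<^sub>R column 2 (X p) \<and>
      column 3 (X' p) = e *\<^sub>R column 3 (X p) \<and> column 4 (X' p) = e *\<^sub>R column 4 (X p)"
    by (rule normal_frame_unique[OF open_D connected_D])
      (use A A' same in \<open>auto simp: Sp4_iff intro: smooth_on_column[OF open_D]\<close>)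
  then obtain e where e: "e \<in> {1, -1}" "\<And>p. p \<in> D \<Longrightarrow> column 1 (X' p) = e *\<^sub>R column 1 (X p) \<and>
      column 2 (X' p) = e *\<^sub>R column 2 (X p) \<and>
      column 3 (X' p) = e *\<^sub>R column 3 (X p) \<and> column 4 (X' p) = e *\<^sub>R column 4 (X p)"
    by blast
  have "column j (e *\<^sub>R M) = e *\<^sub>R column j M" for j and M :: "real^4^4"
    by (simp add: column_def vec_eq_iff)
  then have "X' p = e *\<^sub>R X p" if "p \<in> D" for p
    using e(2)[OF that] by (intro columns_4_eqI) auto
  then show ?thesis
    using e(1) YX by auto
qed

end

theorem proposition1:
  fixes A :: "('m::{t2_space,second_countable_topology}) chart set"
    and f :: "'m \<Rightarrow> real^4"
    and U :: "'m set"
    and z :: "'m \<Rightarrow> complex"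
  assumes "oriented_surface A"
    and "connected (UNIV :: 'm set)"
    and "simply_connected (UNIV :: 'm set)"
    and "elliptic_lagrangian_immersion A f"
    and "complex_parameter A f U z"
  shows "(\<exists>S :: 'm \<Rightarrow> mat5. adapted_frame A f U z S) \<and>
         (\<forall>X X' :: 'm \<Rightarrow> real^4^4.
            adapted_frame A f U z (\<lambda>q. aff (f q) (X q)) \<and>
            adapted_frame A f U z (\<lambda>q. aff (f q) (X' q)) \<longrightarrow>
              (\<forall>q\<in>U. X' q = X q) \<or> (\<forall>q\<in>U. X' q = - X q))"
proof -
  have hol: "holomorphic_chart A f U z" and contr: "contractible U"
    using assms(5) by (auto simp: complex_parameter_def)
  interpret lagrangian_complex_chart A U z f
  proof
    show "oriented_surface A" by fact
    show "complex_chart A U z"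
      using hol by (simp add: holomorphic_chart_def)
    show "0 < Im (cnj (tdiff A z q v) * tdiff A z q w)" if "q \<in> U" "pos_basis A q v w" for q v w
      using hol that unfolding holomorphic_chart_def by blast
    show "lagrangian_immersion A f"
      using assms(4) by (simp add: elliptic_lagrangian_immersion_def)
    show "connected U"
      using contr by (rule contractible_top_connected)
  qed
  have "\<exists>r>0. \<forall>v\<in>tangent_space A q. gform A S q v = r * (cmod (tdiff A z q v))\<^sup>2"
    if "first_order A f U S" "q \<in> U" for S q
    using hol that unfolding holomorphic_chart_def by blast
  then have "\<exists>S. adapted_frame A f U z S"
    by (rule exists_adapted_frame[OF contr])
  then show ?thesis
    using adapted_frame_unique by blast
qed

end
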